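(* Let $n,t$ be positive integers. The number $SG^{\neg v,\neg n}(n,t,1)$ of non-isomorphic simple games with $n$ players, $t$ equivalence classes of players, exactly one minimal winning vector, and neither veto nor null players is $$SG^{\neg v,\neg n}(n,t,1)=\sum_{j_1+2j_2+3j_3+\dots+tj_t=t}\ \frac{1}{\prod_{k=1}^t\left(k^{j_k}\,j_k!\right)}\ \Bigl(F_{k_1,j_{k_1}} * F_{k_2,j_{k_2}} * \cdots * F_{k_s,j_{k_s}}\Bigr)(n),$$ where the sum runs over all tuples $(j_1,\dots,j_t)$ of nonnegative integers with $j_1+2j_2+\dots+tj_t=t$, where $k_1<\dots<k_s$ are the indices $k\in\{1,\dots,t\}$ with $j_k\ne 0$, where for fixed $k,j\geq 1$ the function $F_{k,j}$ of the nonnegative integer $n$ is $$F_{k,j}(n)=\binom{\frac{n-k}{k}\cdot \mathbf 1_{\{n\equiv 0 \bmod k\}}}{2j-1},$$ and $*$ is the discrete convolution.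
   Context: A simple game is a pair $(N,v)$ with $N$ a finite nonempty set of players and $v:2^N\to\{0,1\}$ satisfying $v(\emptyset)=0$, $v(N)=1$ and $v(S)\le v(T)$ whenever $S\subseteq T$. A coalition $S$ is winning if $v(S)=1$ and losing otherwise; it is minimal winning if it is winning and all its proper subsets are losing. Two simple games are isomorphic if there is a bijection of the player sets such that a coalition is winning iff its image is winning. Players $a,b$ are equivalent (equi-desirable) if the transposition of $a$ and $b$ preserves the set of winning coalitions; let $N_1,\dots,N_t$ be the equivalence classes. To a coalition $S$ associate the vector $(|S\cap N_1|,\dots,|S\cap N_t|)$; coalitions with the same vector have the same value under $v$. The vectors of minimal winning coalitions are called minimal winning vectors. A player is null if it belongs to no minimal winning coalition, and veto if it belongs to every winning coalition. $SG^{\neg v,\neg n}(n,t,1)$ is the number of isomorphism classes of simple games with $n$ players, exactly $t$ equivalence classes, exactly one minimal winning vector, and neither null nor veto players. The discrete convolution of functions on the nonnegative integers is $(f*g)(n)=\sum_{k=0}^{n}f(k)g(n-k)$; it is commutative and associative, and the convolution of a single function is that function. $\mathbf 1_{\{\cdot\}}$ is the indicator ($1$ if the condition holds, $0$ otherwise). For integers $a$ and $b\ge 0$, $\binom{a}{b}=0$ whenever $a<b$ (in particular for negative $a$). *)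

theory Defs
  imports Complex_Main "HOL-Library.FuncSet" "HOL-Combinatorics.Transposition"
begin

text \<open>The characteristic function is extensional, i.e. it carries no information outside
  \<open>Pow N\<close>.\<close>

definition simple_game :: "'a set \<Rightarrow> ('a set \<Rightarrow> nat) \<Rightarrow> bool" where
  "simple_game N v \<longleftrightarrow> finite N \<and> N \<noteq> {} \<and> v \<in> Pow N \<rightarrow>\<^sub>E {0, 1} \<and> v {} = 0 \<and> v N = 1 \<and>
     (\<forall>S T. S \<subseteq> T \<and> T \<subseteq> N \<longrightarrow> v S \<le> v T)"

definition winning_coalitions :: "'a set \<Rightarrow> ('a set \<Rightarrow> nat) \<Rightarrow> 'a set set" where
  "winning_coalitions N v = {S. S \<subseteq> N \<and> v S = 1}"

definition minimal_winning_coalitions :: "'a set \<Rightarrow> ('a set \<Rightarrow> nat) \<Rightarrow> 'a set set" where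
  "minimal_winning_coalitions N v =
     {S \<in> winning_coalitions N v. \<forall>T. T \<subset> S \<longrightarrow> T \<notin> winning_coalitions N v}"

definition null_player :: "'a set \<Rightarrow> ('a set \<Rightarrow> nat) \<Rightarrow> 'a \<Rightarrow> bool" where
  "null_player N v a \<longleftrightarrow> a \<in> N \<and> (\<forall>S\<in>minimal_winning_coalitions N v. a \<notin> S)"

definition veto_player :: "'a set \<Rightarrow> ('a set \<Rightarrow> nat) \<Rightarrow> 'a \<Rightarrow> bool" where
  "veto_player N v a \<longleftrightarrow> a \<in> N \<and> (\<forall>S\<in>winning_coalitions N v. a \<in> S)"

definition equi_desirable :: "'a set \<Rightarrow> ('a set \<Rightarrow> nat) \<Rightarrow> ('a \<times> 'a) set" where
  "equi_desirable N v = {(a, b). a \<in> N \<and> b \<in> N \<and>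
     (\<lambda>S. transpose a b ` S) ` winning_coalitions N v = winning_coalitions N v}"

definition player_classes :: "'a set \<Rightarrow> ('a set \<Rightarrow> nat) \<Rightarrow> 'a set set" where
  "player_classes N v = N // equi_desirable N v"

text \<open>The vector of a coalition is indexed by the equivalence classes themselves rather than by
  an enumeration \<open>N\<^sub>1, \<dots>, N\<^sub>t\<close> of them; the number of distinct vectors is the same.\<close>

definition coalition_vector :: "'a set \<Rightarrow> ('a set \<Rightarrow> nat) \<Rightarrow> 'a set \<Rightarrow> ('a set \<Rightarrow> nat)" where
  "coalition_vector N v S = (\<lambda>C\<in>player_classes N v. card (S \<inter> C))"

definition minimal_winning_vectors :: "'a set \<Rightarrow> ('a set \<Rightarrow> nat) \<Rightarrow> ('a set \<Rightarrow> nat) set" where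
  "minimal_winning_vectors N v = coalition_vector N v ` minimal_winning_coalitions N v"

definition isomorphic_games ::
    "'a set \<times> ('a set \<Rightarrow> nat) \<Rightarrow> 'b set \<times> ('b set \<Rightarrow> nat) \<Rightarrow> bool" where
  "isomorphic_games G H \<longleftrightarrow>
     (\<exists>f. bij_betw f (fst G) (fst H) \<and>
        (\<forall>S. S \<subseteq> fst G \<longrightarrow>
           (S \<in> winning_coalitions (fst G) (snd G) \<longleftrightarrow>
            f ` S \<in> winning_coalitions (fst H) (snd H))))"

text \<open>To have a set of games to count, players are natural numbers; \<open>simple_game_on_nat\<close> below
  shows that every simple game is isomorphic to one of this kind.\<close>

definition SG_games :: "nat \<Rightarrow> nat \<Rightarrow> nat \<Rightarrow> (nat set \<times> (nat set \<Rightarrow> nat)) set" where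
  "SG_games n t r = {(N, v). simple_game N v \<and> card N = n \<and>
     card (player_classes N v) = t \<and> card (minimal_winning_vectors N v) = r \<and>
     (\<nexists>a. veto_player N v a) \<and> (\<nexists>a. null_player N v a)}"

definition isomorphism_classes ::
    "('a set \<times> ('a set \<Rightarrow> nat)) set \<Rightarrow> ('a set \<times> ('a set \<Rightarrow> nat)) set set" where
  "isomorphism_classes \<G> = \<G> // {(G, H). G \<in> \<G> \<and> H \<in> \<G> \<and> isomorphic_games G H}"

definition SG_no_veto_no_null :: "nat \<Rightarrow> nat \<Rightarrow> nat \<Rightarrow> nat" where
  "SG_no_veto_no_null n t r = card (isomorphism_classes (SG_games n t r))"

lemma transpose_image_winning_iff:
  assumes "(a, b) \<in> equi_desirable N v"
  shows "transpose a b ` S \<in> winning_coalitions N v \<longleftrightarrow> S \<in> winning_coalitions N v"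
proof -
  let ?W = "winning_coalitions N v"
  have eq: "(\<lambda>S. transpose a b ` S) ` ?W = ?W"
    using assms by (simp add: equi_desirable_def)
  have inv: "transpose a b ` transpose a b ` S = S"
    by (simp add: image_image)
  show ?thesis
  proof
    assume "transpose a b ` S \<in> ?W"
    then have "transpose a b ` transpose a b ` S \<in> ?W" using eq by blast
    then show "S \<in> ?W" by (simp only: inv)
  qed (use eq in blast)
qed

lemma equi_desirableI:
  assumes "a \<in> N" "b \<in> N"
    and "\<And>S. S \<in> winning_coalitions N v \<Longrightarrow> transpose a b ` S \<in> winning_coalitions N v"
  shows "(a, b) \<in> equi_desirable N v"
proof -
  let ?W = "winning_coalitions N v"
  have "S \<in> (\<lambda>S. transpose a b ` S) ` ?W" if "S \<in> ?W" for S
  proof (rule image_eqI)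
    show "S = transpose a b ` transpose a b ` S" by (simp add: image_image)
  qed (rule assms(3)[OF that])
  then have "(\<lambda>S. transpose a b ` S) ` ?W = ?W" using assms(3) by blast
  then show ?thesis using assms by (simp add: equi_desirable_def)
qed

lemma equiv_equi_desirable: "equiv N (equi_desirable N v)"
proof (rule equivI)
  show "equi_desirable N v \<subseteq> N \<times> N" by (auto simp: equi_desirable_def)
  show "refl_on N (equi_desirable N v)"
    by (auto intro!: refl_onI equi_desirableI)
  show "sym (equi_desirable N v)"
    by (auto intro!: symI simp: equi_desirable_def transpose_commute)
  show "trans (equi_desirable N v)"
  proof (rule transI)
    fix a b c
    assume ab: "(a, b) \<in> equi_desirable N v" and bc: "(b, c) \<in> equi_desirable N v"
    have N: "a \<in> N" "b \<in> N" "c \<in> N"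
      using ab bc by (auto simp: equi_desirable_def)
    show "(a, c) \<in> equi_desirable N v"
    proof (cases "a = b \<or> b = c \<or> a = c")
      case True
      then show ?thesis
        using ab bc N by (auto intro!: equi_desirableI)
    next
      case False
      then have "transpose a c = transpose a b \<circ> transpose b c \<circ> transpose a b"
        by (auto simp: fun_eq_iff transpose_def)
      then have "transpose a c ` S = transpose a b ` transpose b c ` transpose a b ` S" for S
        by (simp only: image_comp o_assoc)
      then show ?thesis
        using N by (intro equi_desirableI)
          (simp_all only: transpose_image_winning_iff[OF ab] transpose_image_winning_iff[OF bc])
    qed
  qed
qed

lemma equiv_isomorphic_games:
  "equiv \<G> {(G, H). G \<in> \<G> \<and> H \<in> \<G> \<and> isomorphic_games G H}"
proof (rule equivI)
  show "refl_on \<G> {(G, H). G \<in> \<G> \<and> H \<in> \<G> \<and> isomorphic_games G H}"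
    by (auto intro!: refl_onI exI[of _ id] simp: isomorphic_games_def)
  have "isomorphic_games H G" if "isomorphic_games G H" for G H :: "'a set \<times> ('a set \<Rightarrow> nat)"
  proof -
    from that obtain f where f: "bij_betw f (fst G) (fst H)"
      and W: "\<And>S. S \<subseteq> fst G \<Longrightarrow> S \<in> winning_coalitions (fst G) (snd G) \<longleftrightarrow>
            f ` S \<in> winning_coalitions (fst H) (snd H)"
      by (auto simp: isomorphic_games_def)
    let ?g = "inv_into (fst G) f"
    have "bij_betw ?g (fst H) (fst G)" using f by (rule bij_betw_inv_into)
    moreover have "S \<in> winning_coalitions (fst H) (snd H) \<longleftrightarrow>
        ?g ` S \<in> winning_coalitions (fst G) (snd G)" if "S \<subseteq> fst H" for S
      using W[of "?g ` S"] f that calculation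
      by (metis bij_betw_def image_inv_into_cancel image_mono)
    ultimately show ?thesis by (auto simp: isomorphic_games_def)
  qed
  then show "sym {(G, H). G \<in> \<G> \<and> H \<in> \<G> \<and> isomorphic_games G H}"
    by (auto intro!: symI)
  have "isomorphic_games G K" if GH: "isomorphic_games G H" and HK: "isomorphic_games H K"
    for G H K :: "'a set \<times> ('a set \<Rightarrow> nat)"
  proof -
    from GH obtain f where f: "bij_betw f (fst G) (fst H)"
      and W: "\<And>S. S \<subseteq> fst G \<Longrightarrow> S \<in> winning_coalitions (fst G) (snd G) \<longleftrightarrow>
            f ` S \<in> winning_coalitions (fst H) (snd H)"
      by (auto simp: isomorphic_games_def)
    from HK obtain g where g: "bij_betw g (fst H) (fst K)"
      and V: "\<And>S. S \<subseteq> fst H \<Longrightarrow> S \<in> winning_coalitions (fst H) (snd H) \<longleftrightarrow>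
            g ` S \<in> winning_coalitions (fst K) (snd K)"
      by (auto simp: isomorphic_games_def)
    have "bij_betw (g \<circ> f) (fst G) (fst K)" using f g by (rule bij_betw_trans)
    moreover have "S \<in> winning_coalitions (fst G) (snd G) \<longleftrightarrow>
        (g \<circ> f) ` S \<in> winning_coalitions (fst K) (snd K)" if "S \<subseteq> fst G" for S
      using W[OF that] V[of "f ` S"] f that
      by (metis bij_betw_def image_comp image_mono)
    ultimately show ?thesis by (auto simp: isomorphic_games_def)
  qed
  then show "trans {(G, H). G \<in> \<G> \<and> H \<in> \<G> \<and> isomorphic_games G H}"
    by (blast intro!: transI)
qed auto

lemma simple_game_on_nat:
  assumes "simple_game N v"
  shows "\<exists>w. simple_game {..<card N} w \<and> isomorphic_games (N, v) ({..<card N}, w)"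
proof -
  let ?M = "{..<card N}"
  have "finite N" using assms by (simp add: simple_game_def)
  then obtain g where g: "bij_betw g ?M N"
    by (metis atLeast0LessThan ex_bij_betw_nat_finite)
  define w where "w = (\<lambda>S\<in>Pow ?M. v (g ` S))"
  have gN: "g ` ?M = N" using g by (simp add: bij_betw_def)
  have sub: "g ` S \<subseteq> N" if "S \<subseteq> ?M" for S using that gN by blast
  have "simple_game ?M w"
    unfolding simple_game_def
  proof (intro conjI allI impI)
    show "?M \<noteq> {}" using assms by (auto simp: simple_game_def lessThan_empty_iff)
    show "w \<in> Pow ?M \<rightarrow>\<^sub>E {0, 1}"
    proof (rule PiE_I)
      fix S assume "S \<in> Pow ?M"
      then show "w S \<in> {0, 1}"
        using assms sub[of S] unfolding w_def simple_game_def by (auto simp: PiE_iff)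
    qed (auto simp: w_def)
    show "w {} = 0" "w ?M = 1"
      using assms gN by (auto simp: w_def simple_game_def)
    show "w S \<le> w T" if "S \<subseteq> T \<and> T \<subseteq> ?M" for S T
    proof -
      have "g ` S \<subseteq> g ` T" "g ` T \<subseteq> N" "S \<subseteq> ?M" using that sub[of T] by auto
      then show ?thesis using assms that by (simp add: w_def simple_game_def)
    qed
  qed simp
  moreover have "isomorphic_games (N, v) (?M, w)"
    unfolding isomorphic_games_def
  proof (intro exI conjI allI impI)
    let ?f = "inv_into ?M g"
    show f: "bij_betw ?f (fst (N, v)) (fst (?M, w))"
      using g by (simp add: bij_betw_inv_into)
    fix S assume "S \<subseteq> fst (N, v)"
    then have S: "S \<subseteq> N" by simp
    then have "g ` ?f ` S = S" "?f ` S \<subseteq> ?M"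
      using gN f by (auto simp: image_inv_into_cancel bij_betw_def)
    then show "S \<in> winning_coalitions (fst (N, v)) (snd (N, v)) \<longleftrightarrow>
        ?f ` S \<in> winning_coalitions (fst (?M, w)) (snd (?M, w))"
      using S by (simp add: winning_coalitions_def w_def)
  qed
  ultimately show ?thesis by blast
qed

text \<open>Here \<open>int_binomial a b = 0\<close> for all negative \<open>a\<close>, unlike \<open>a gchoose b\<close>, which for such \<open>a\<close> is
  \<open>\<plusminus> ((b - a - 1) choose b)\<close>.\<close>

definition int_binomial :: "int \<Rightarrow> nat \<Rightarrow> nat" where
  "int_binomial a b = (if a < 0 then 0 else nat a choose b)"

text \<open>If \<open>k\<close> divides \<open>n\<close> then \<open>div\<close> is exact; otherwise the indicator makes its value
  irrelevant.\<close>

definition F :: "nat \<Rightarrow> nat \<Rightarrow> nat \<Rightarrow> nat" where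
  "F k j n = int_binomial ((int n - int k) div int k * of_bool (n mod k = 0)) (2 * j - 1)"

definition dconv :: "(nat \<Rightarrow> nat) \<Rightarrow> (nat \<Rightarrow> nat) \<Rightarrow> nat \<Rightarrow> nat" where
  "dconv f g n = (\<Sum>k=0..n. f k * g (n - k))"

text \<open>The value for the empty list, the unit of \<open>dconv\<close>, is never used when \<open>t > 0\<close>.\<close>

fun dconv_list :: "(nat \<Rightarrow> nat) list \<Rightarrow> nat \<Rightarrow> nat" where
  "dconv_list [] = (\<lambda>n. of_bool (n = 0))"
| "dconv_list [f] = f"
| "dconv_list (f # g # fs) = dconv f (dconv_list (g # fs))"

definition cycle_types :: "nat \<Rightarrow> (nat \<Rightarrow> nat) set" where
  "cycle_types t = {j \<in> {1..t} \<rightarrow>\<^sub>E UNIV. (\<Sum>k=1..t. k * j k) = t}"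

lemma finite_cycle_types: "finite (cycle_types t)"
proof (rule finite_subset)
  show "cycle_types t \<subseteq> {1..t} \<rightarrow>\<^sub>E {..t}"
  proof
    fix j assume "j \<in> cycle_types t"
    then have j: "j \<in> extensional {1..t}" and s: "(\<Sum>k=1..t. k * j k) = t"
      by (auto simp: cycle_types_def PiE_iff)
    have "j k \<le> t" if "k \<in> {1..t}" for k
    proof -
      have "j k \<le> k * j k" using that by simp
      also have "\<dots> \<le> (\<Sum>k=1..t. k * j k)"
        by (rule member_le_sum[OF that]) auto
      finally show ?thesis using s by simp
    qed
    then show "j \<in> {1..t} \<rightarrow>\<^sub>E {..t}" using j by (simp add: PiE_iff)
  qed
  show "finite ({1..t} \<rightarrow>\<^sub>E {..t})" by (rule finite_PiE) auto
qed

end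

theory Submission
  imports Defs "HOL-Library.Disjoint_Sets" "HOL-Library.Multiset"
    "HOL-Computational_Algebra.Formal_Power_Series"
begin

text \<open>If all minimal winning coalitions of a game have the same vector \<open>q\<close>, then a coalition wins iff
it contains at least \<open>q C\<close> players of each class \<open>C\<close>: it needs that many because it contains a
minimal winning coalition, and that many suffice because coalitions with equal vectors have equal
values. There is no null player iff every \<open>q C\<close> is positive, and no veto player iff every \<open>q C\<close> is
less than the size of \<open>C\<close>. Conversely, quotas strictly between \<open>0\<close> and the block sizes of an
arbitrary partition of a finite nonempty set define such a game whose classes are exactly the
blocks. Up to isomorphism the game is therefore a multiset of \<open>t\<close> pairs \<open>(q C, card C - q C)\<close> of positive integers with total
sum \<open>n\<close> (lemma \<open>SG_eq_card_weighted_multisets\<close>).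

The right-hand side is Polya's count of these multisets: the cycle index of the symmetric group
on \<open>t\<close> points with the power sums \<open>p\<^sub>k = (\<Sum>x. X^(k * (fst x + snd x)))\<close> substituted, where \<open>x\<close>
ranges over pairs of positive integers. Instead of counting orbits of the symmetric group, the
proof uses Newton's identity \<open>t * h\<^sub>t = (\<Sum>k=1..t. p\<^sub>k * h\<^bsub>t-k\<^esub>)\<close>. The generating function \<open>h\<^sub>t\<close>
of the multisets of size \<open>t\<close> satisfies it by marking some copies of one element and splitting
them off (lemma \<open>weighted_multisets_recurrence\<close>), and the cycle index satisfies it by splitting off
one cycle (lemma \<open>cycle_sum_recurrence\<close>). The identity determines \<open>h\<^sub>t\<close> from \<open>h\<^sub>0 = 1\<close>.

It remains to expand powers of the power sums. As \<open>p\<^sub>k = (X^k / (1 - X^k))^2\<close>, the coefficients of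
\<open>p\<^sub>k ^ j\<close> are the binomial coefficients \<open>F k j\<close> (lemma \<open>dilated_binomial_gf_power\<close>), and
convolution of sequences is multiplication of power series.\<close>

section \<open>Winning coalitions and the vectors of coalitions\<close>

lemma winning_mono:
  assumes "simple_game N v" "S \<in> winning_coalitions N v" "S \<subseteq> T" "T \<subseteq> N"
  shows "T \<in> winning_coalitions N v"
proof -
  have "v S \<le> v T"
    using assms(1,3,4) unfolding simple_game_def by blast
  moreover have "v S = 1" using assms(2) by (simp add: winning_coalitions_def)
  moreover have "v T \<in> {0, 1}"
    using assms(1,4) by (metis PiE_mem Pow_iff simple_game_def)
  ultimately have "v T = 1" by auto
  then show ?thesis using assms(4) by (simp add: winning_coalitions_def)
qed

lemma ex_minimal_winning_subset:
  assumes "simple_game N v" "S \<in> winning_coalitions N v"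
  shows "\<exists>T\<in>minimal_winning_coalitions N v. T \<subseteq> S"
proof -
  let ?A = "winning_coalitions N v"
  have "?A \<subseteq> Pow N" by (auto simp: winning_coalitions_def)
  then have "finite ?A"
    using assms(1) by (metis finite_Pow_iff finite_subset simple_game_def)
  from finite_has_minimal2[OF this assms(2)] obtain T
    where "T \<in> ?A" "T \<subseteq> S" "\<forall>U\<in>?A. U \<subseteq> T \<longrightarrow> T = U" by blast
  then have "T \<in> minimal_winning_coalitions N v" "T \<subseteq> S"
    unfolding minimal_winning_coalitions_def by auto
  then show ?thesis by blast
qed

lemma grand_coalition_winning: "simple_game N v \<Longrightarrow> N \<in> winning_coalitions N v"
  by (simp add: simple_game_def winning_coalitions_def)

lemma partition_on_player_classes: "partition_on N (player_classes N v)"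
  unfolding player_classes_def by (rule partition_on_quotient[OF equiv_equi_desirable])

lemma card_transpose_image_Int:
  assumes "a \<in> D \<longleftrightarrow> b \<in> D"
  shows "card (transpose a b ` S \<inter> D) = card (S \<inter> D)"
proof -
  have "transpose a b ` D = D" using assms by (rule transpose_image_eq)
  then have "transpose a b ` S \<inter> D = transpose a b ` (S \<inter> D)"
    by (metis image_Int inj_transpose)
  then show ?thesis by (simp add: card_image inj_on_subset[OF inj_transpose])
qed

text \<open>As long as \<open>S\<close> is not contained in \<open>T\<close>, some \<open>a \<in> S - T\<close> can be exchanged for an equivalent
\<open>b \<in> T - S\<close>, because \<open>S\<close> and \<open>T\<close> have equally many members in the class of \<open>a\<close>. The exchange is a
transposition of equivalent players, so it keeps both the vector and the value, and it brings \<open>S\<close>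
closer to \<open>T\<close>.\<close>

lemma winning_same_vector:
  assumes "simple_game N v" "S \<in> winning_coalitions N v" "T \<subseteq> N"
    and "\<And>C. C \<in> player_classes N v \<Longrightarrow> card (S \<inter> C) = card (T \<inter> C)"
  shows "T \<in> winning_coalitions N v"
  using assms(2,4)
proof (induction "card (S - T)" arbitrary: S rule: less_induct)
  case less
  have "S \<subseteq> N" using less.prems(1) by (simp add: winning_coalitions_def)
  have fin: "finite S" "finite T"
    using assms(1,3) \<open>S \<subseteq> N\<close> by (auto simp: simple_game_def intro: finite_subset)
  show ?case
  proof (cases "S \<subseteq> T")
    case True
    then show ?thesis using winning_mono assms(1,3) less.prems(1) by blast
  next
    case False
    then obtain a where a: "a \<in> S" "a \<notin> T" by blast
    then have "a \<in> \<Union>(player_classes N v)"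
      using \<open>S \<subseteq> N\<close> partition_onD1[OF partition_on_player_classes[of N v]] by auto
    then obtain C where C: "C \<in> player_classes N v" "a \<in> C" by blast
    have "\<not> T \<inter> C \<subseteq> S"
    proof
      assume "T \<inter> C \<subseteq> S"
      then have "T \<inter> C \<subset> S \<inter> C" using a C by blast
      then have "card (T \<inter> C) < card (S \<inter> C)" using fin by (intro psubset_card_mono) auto
      then show False using less.prems(2)[OF C(1)] by simp
    qed
    then obtain b where b: "b \<in> T" "b \<in> C" "b \<notin> S" by blast
    have ab: "(a, b) \<in> equi_desirable N v"
      using C b(2) in_quotient_imp_in_rel[OF equiv_equi_desirable]
      unfolding player_classes_def by fast
    let ?S = "transpose a b ` S"
    have S_eq: "?S = insert b (S - {a})"
      using a b by (auto simp: transpose_def image_iff split: if_splits)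
    have "?S - T = (S - T) - {a}" unfolding S_eq using b by blast
    then have "card (?S - T) < card (S - T)"
      using a fin by (metis DiffI card_Diff1_less finite_Diff)
    moreover have "?S \<in> winning_coalitions N v"
      using transpose_image_winning_iff[OF ab] less.prems(1) by blast
    moreover have "card (?S \<inter> D) = card (T \<inter> D)" if D: "D \<in> player_classes N v" for D
    proof -
      have "a \<in> D \<longleftrightarrow> b \<in> D"
        using C b(2) D partition_onD2[OF partition_on_player_classes[of N v]]
        by (auto simp: disjoint_def)
      then show ?thesis using less.prems(2)[OF D] by (simp add: card_transpose_image_Int)
    qed
    ultimately show ?thesis by (rule less.hyps)
  qed
qed

section \<open>Games given by one quota for each block of a partition\<close>

text \<open>The partition is a parameter, not the partition into equivalence classes. Hence the image of such
a game under an isomorphism is one by construction, and a game can be built from any partition;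
that the blocks are the equivalence classes is then a theorem.\<close>

definition quota_game ::
    "'a set \<Rightarrow> ('a set \<Rightarrow> nat) \<Rightarrow> 'a set set \<Rightarrow> ('a set \<Rightarrow> nat) \<Rightarrow> bool" where
  "quota_game N v P q \<longleftrightarrow> simple_game N v \<and> partition_on N P \<and>
     (\<forall>C\<in>P. 0 < q C \<and> q C < card C) \<and>
     winning_coalitions N v = {S. S \<subseteq> N \<and> (\<forall>C\<in>P. q C \<le> card (S \<inter> C))}"

lemma ex_subset_with_vector:
  assumes "partition_on N P" "\<And>C. C \<in> P \<Longrightarrow> q C \<le> card (S \<inter> C)"
  shows "\<exists>T\<subseteq>S. \<forall>C\<in>P. card (T \<inter> C) = q C"
proof -
  have "\<forall>C\<in>P. \<exists>A\<subseteq>S \<inter> C. card A = q C"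
    using assms(2) by (metis obtain_subset_with_card_n)
  then obtain A where A: "\<And>C. C \<in> P \<Longrightarrow> A C \<subseteq> S \<inter> C \<and> card (A C) = q C" by metis
  have "(\<Union>D\<in>P. A D) \<inter> C = A C" if C: "C \<in> P" for C
    using A C partition_onD2[OF assms(1)] by (fastforce simp: disjoint_def)
  then show ?thesis
    using A by (intro exI[of _ "\<Union>D\<in>P. A D"]) (simp add: UN_least)
qed

text \<open>Each quota is positive because a player of the class occurs in some minimal winning coalition, and
below the size of the class because some winning coalition misses a player of the class.\<close>

lemma quota_game_of_SG:
  assumes "(N, v) \<in> SG_games n t 1"
  shows "\<exists>q. quota_game N v (player_classes N v) q"
proof -
  let ?P = "player_classes N v" and ?W = "winning_coalitions N v"
  have sg: "simple_game N v" and one: "card (minimal_winning_vectors N v) = 1"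
    and veto: "\<nexists>a. veto_player N v a" and null: "\<nexists>a. null_player N v a"
    using assms by (auto simp: SG_games_def)
  have fin: "finite N" using sg by (simp add: simple_game_def)
  have part: "partition_on N ?P" by (rule partition_on_player_classes)
  obtain q where q: "minimal_winning_vectors N v = {q}"
    using one by (auto simp: card_1_singleton_iff)
  have mw: "card (S \<inter> C) = q C" if "S \<in> minimal_winning_coalitions N v" "C \<in> ?P" for S C
  proof -
    have "coalition_vector N v S = q" using q that by (auto simp: minimal_winning_vectors_def)
    then show ?thesis using that(2) by (auto simp: coalition_vector_def)
  qed
  have W: "?W = {S. S \<subseteq> N \<and> (\<forall>C\<in>?P. q C \<le> card (S \<inter> C))}"
  proof (intro equalityI subsetI)
    fix S assume S: "S \<in> ?W"
    then have sub: "S \<subseteq> N" by (simp add: winning_coalitions_def)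
    obtain T where T: "T \<in> minimal_winning_coalitions N v" "T \<subseteq> S"
      using ex_minimal_winning_subset[OF sg S] by blast
    have "q C \<le> card (S \<inter> C)" if C: "C \<in> ?P" for C
    proof -
      have "card (T \<inter> C) \<le> card (S \<inter> C)"
        using T(2) fin sub by (intro card_mono) (auto intro: finite_subset)
      then show ?thesis using mw[OF T(1) C] by simp
    qed
    then show "S \<in> {S. S \<subseteq> N \<and> (\<forall>C\<in>?P. q C \<le> card (S \<inter> C))}" using sub by blast
  next
    fix S assume "S \<in> {S. S \<subseteq> N \<and> (\<forall>C\<in>?P. q C \<le> card (S \<inter> C))}"
    then have S: "S \<subseteq> N" "\<And>C. C \<in> ?P \<Longrightarrow> q C \<le> card (S \<inter> C)" by auto
    obtain T where T: "T \<subseteq> S" "\<And>C. C \<in> ?P \<Longrightarrow> card (T \<inter> C) = q C"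
      using ex_subset_with_vector[OF part S(2)] by blast
    \<comment> \<open>\<open>T\<close> has the vector of any minimal winning coalition, hence wins.\<close>
    obtain M where M: "M \<in> minimal_winning_coalitions N v"
      using ex_minimal_winning_subset[OF sg grand_coalition_winning[OF sg]] by blast
    then have "M \<in> ?W" by (simp add: minimal_winning_coalitions_def)
    then have "T \<in> ?W"
      using winning_same_vector[OF sg, of M T] mw[OF M] T S(1) by auto
    then show "S \<in> ?W" using winning_mono[OF sg] T(1) S(1) by blast
  qed
  have "0 < q C \<and> q C < card C" if C: "C \<in> ?P" for C
  proof -
    have "C \<subseteq> N" "C \<noteq> {}"
      using partition_onD1[OF part] partition_onD3[OF part] C by auto
    then obtain a where a: "a \<in> C" "a \<in> N" by blast
    have finC: "finite C" using \<open>C \<subseteq> N\<close> fin by (rule finite_subset)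
    obtain M where M: "M \<in> minimal_winning_coalitions N v" "a \<in> M"
      using null a by (auto simp: null_player_def)
    have "M \<inter> C \<noteq> {}" using a M by blast
    then have pos: "0 < q C" using mw[OF M(1) C] finC by (metis card_gt_0_iff finite_Int)
    obtain S where S: "S \<in> ?W" "a \<notin> S"
      using veto a by (auto simp: veto_player_def)
    have "q C \<le> card (S \<inter> C)" using S W C by auto
    also have "\<dots> < card C" using S a finC by (intro psubset_card_mono) auto
    finally show ?thesis using pos by blast
  qed
  then show ?thesis using sg part W unfolding quota_game_def by blast
qed

context
  fixes N :: "'a set" and v P q
  assumes qg: "quota_game N v P q"
begin

lemma quota_game_simps:
  shows "simple_game N v" "partition_on N P" "finite N"
    "C \<in> P \<Longrightarrow> 0 < q C" "C \<in> P \<Longrightarrow> q C < card C"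
    "S \<in> winning_coalitions N v \<longleftrightarrow> S \<subseteq> N \<and> (\<forall>C\<in>P. q C \<le> card (S \<inter> C))"
    "C \<in> P \<Longrightarrow> C \<subseteq> N" "C \<in> P \<Longrightarrow> finite C"
proof -
  show "simple_game N v" and part: "partition_on N P" and fin: "finite N"
    using qg by (auto simp: quota_game_def simple_game_def)
  show "C \<in> P \<Longrightarrow> 0 < q C" "C \<in> P \<Longrightarrow> q C < card C"
    "S \<in> winning_coalitions N v \<longleftrightarrow> S \<subseteq> N \<and> (\<forall>C\<in>P. q C \<le> card (S \<inter> C))"
    using qg by (auto simp: quota_game_def)
  show sub: "C \<in> P \<Longrightarrow> C \<subseteq> N" using partition_onD1[OF part] by blast
  show "C \<in> P \<Longrightarrow> finite C" using sub fin finite_subset by blast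
qed

lemma quota_game_disjoint: "C \<in> P \<Longrightarrow> D \<in> P \<Longrightarrow> a \<in> C \<Longrightarrow> a \<in> D \<Longrightarrow> C = D"
  using partition_onD2[OF quota_game_simps(2)] by (auto simp: disjoint_def)

text \<open>These coalitions meet the quota of \<open>C\<close> with nothing to spare, and no other block stops them from
winning: every other block loses at most one player, and its quota is below its size.\<close>

lemma quota_game_tight_coalition:
  assumes "C \<in> P" "A \<subseteq> C" "card A = q C" "B \<subseteq> N - C"
    "\<And>D. D \<in> P \<Longrightarrow> D \<noteq> C \<Longrightarrow> card (D \<inter> B) \<le> 1"
  shows "A \<union> (N - C - B) \<in> winning_coalitions N v" "(A \<union> (N - C - B)) \<inter> C = A"
proof -
  show A: "(A \<union> (N - C - B)) \<inter> C = A" using assms(2) by blast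
  have "q D \<le> card ((A \<union> (N - C - B)) \<inter> D)" if D: "D \<in> P" for D
  proof (cases "D = C")
    case True
    then show ?thesis using A assms(3) by simp
  next
    case False
    then have "D \<inter> C = {}" using quota_game_disjoint[OF D assms(1)] by blast
    then have "(A \<union> (N - C - B)) \<inter> D = D - D \<inter> B"
      using quota_game_simps(7)[OF D] assms(2) by blast
    moreover have "card (D - D \<inter> B) = card D - card (D \<inter> B)"
      using quota_game_simps(8)[OF D] by (intro card_Diff_subset) auto
    ultimately show ?thesis
      using assms(5)[OF D False] quota_game_simps(5)[OF D] by simp
  qed
  moreover have "A \<union> (N - C - B) \<subseteq> N" using assms(1,2) quota_game_simps(7) by blast
  ultimately show "A \<union> (N - C - B) \<in> winning_coalitions N v"
    by (simp add: quota_game_simps(6))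
qed

lemma quota_game_ex_quota_subset:
  assumes "C \<in> P" "a \<in> C"
  shows "\<exists>A\<subseteq>C. a \<in> A \<and> card A = q C"
proof -
  have "q C - 1 \<le> card (C - {a})"
    using quota_game_simps(5)[OF assms(1)] quota_game_simps(8)[OF assms(1)] assms(2) by simp
  then obtain A where A: "A \<subseteq> C - {a}" "card A = q C - 1" "finite A"
    by (rule obtain_subset_with_card_n)
  then have "card (insert a A) = q C"
    using quota_game_simps(4)[OF assms(1)] by (subst card_insert_disjoint) auto
  then show ?thesis using A assms(2) by (intro exI[of _ "insert a A"]) auto
qed

text \<open>A transposition within a block changes no count. For \<open>a \<in> C\<close> and \<open>b \<notin> C\<close>, take a coalition that
meets the quota of \<open>C\<close> exactly, using \<open>a\<close>, and contains all players outside \<open>C\<close> except \<open>b\<close>; it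
wins, but putting \<open>b\<close> in place of \<open>a\<close> leaves it one player short in \<open>C\<close>.\<close>

lemma quota_game_equi_desirable_iff:
  "(a, b) \<in> equi_desirable N v \<longleftrightarrow> (\<exists>C\<in>P. a \<in> C \<and> b \<in> C)"
proof
  assume "\<exists>C\<in>P. a \<in> C \<and> b \<in> C"
  then obtain C where C: "C \<in> P" "a \<in> C" "b \<in> C" by blast
  have ab: "a \<in> N" "b \<in> N" using C quota_game_simps(7) by auto
  show "(a, b) \<in> equi_desirable N v"
  proof (rule equi_desirableI)
    fix S assume S: "S \<in> winning_coalitions N v"
    have "card (transpose a b ` S \<inter> D) = card (S \<inter> D)" if "D \<in> P" for D
      using quota_game_disjoint[OF C(1) that] C by (intro card_transpose_image_Int) auto
    moreover have "transpose a b ` S \<subseteq> N"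
      using S ab by (auto simp: quota_game_simps(6) transpose_def)
    ultimately show "transpose a b ` S \<in> winning_coalitions N v"
      using S by (auto simp: quota_game_simps(6))
  qed (use ab in auto)
next
  assume ab: "(a, b) \<in> equi_desirable N v"
  then have N: "a \<in> N" "b \<in> N" by (auto simp: equi_desirable_def)
  then obtain C where C: "C \<in> P" "a \<in> C"
    using partition_onD1[OF quota_game_simps(2)] by auto
  have "b \<in> C"
  proof (rule ccontr)
    assume b: "b \<notin> C"
    obtain A where A: "A \<subseteq> C" "a \<in> A" "card A = q C"
      using quota_game_ex_quota_subset[OF C] by blast
    let ?S = "A \<union> (N - C - {b})"
    have "card (D \<inter> {b}) \<le> 1" for D by (simp add: Int_insert_right)
    then have "?S \<in> winning_coalitions N v"
      using quota_game_tight_coalition(1)[OF C(1) A(1) A(3), of "{b}"] N b by blast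
    then have "transpose a b ` ?S \<in> winning_coalitions N v"
      using transpose_image_winning_iff[OF ab] by blast
    then have "q C \<le> card (transpose a b ` ?S \<inter> C)" using C by (simp add: quota_game_simps(6))
    also have "transpose a b ` ?S \<inter> C \<subseteq> A - {a}"
      using b A C by (auto simp: transpose_def split: if_splits)
    then have "card (transpose a b ` ?S \<inter> C) \<le> card (A - {a})"
      using A(1) quota_game_simps(8)[OF C(1)] by (intro card_mono) (auto intro: finite_subset)
    also have "\<dots> < card A"
      using A quota_game_simps(8)[OF C(1)] by (intro card_Diff1_less) (auto intro: finite_subset)
    finally show False using A(3) by simp
  qed
  then show "\<exists>C\<in>P. a \<in> C \<and> b \<in> C" using C by blast
qed

lemma quota_game_player_classes: "player_classes N v = P"
proof -
  have "equi_desirable N v = {(a, b). \<exists>C\<in>P. a \<in> C \<and> b \<in> C}"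
    using quota_game_equi_desirable_iff by auto
  then show ?thesis
    unfolding player_classes_def using partition_on_eq_quotient[OF quota_game_simps(2)] by simp
qed

text \<open>A player in excess of the quota could be removed without losing.\<close>

lemma quota_game_minimal_winning_vector:
  assumes "S \<in> minimal_winning_coalitions N v" "C \<in> P"
  shows "card (S \<inter> C) = q C"
proof (rule ccontr)
  assume ne: "card (S \<inter> C) \<noteq> q C"
  have S: "S \<subseteq> N" "\<And>D. D \<in> P \<Longrightarrow> q D \<le> card (S \<inter> D)"
    using assms(1) by (auto simp: minimal_winning_coalitions_def quota_game_simps(6))
  have fin: "finite (S \<inter> D)" for D using S(1) quota_game_simps(3) finite_subset by blast
  have big: "q C < card (S \<inter> C)" using ne S(2)[OF assms(2)] by simp
  then obtain a where a: "a \<in> S" "a \<in> C" by (metis card.empty disjoint_iff not_less_zero)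
  have "q D \<le> card ((S - {a}) \<inter> D)" if D: "D \<in> P" for D
  proof (cases "D = C")
    case True
    have "(S - {a}) \<inter> C = S \<inter> C - {a}" by blast
    then show ?thesis using True big a fin by simp
  next
    case False
    then have "(S - {a}) \<inter> D = S \<inter> D"
      using quota_game_disjoint[OF D assms(2)] a by blast
    then show ?thesis using S(2)[OF D] by simp
  qed
  then have "S - {a} \<in> winning_coalitions N v" using S(1) by (auto simp: quota_game_simps(6))
  moreover have "S - {a} \<subset> S" using a by blast
  ultimately show False using assms(1) by (auto simp: minimal_winning_coalitions_def)
qed

lemma quota_game_one_minimal_winning_vector: "card (minimal_winning_vectors N v) = 1"
proof -
  have sg: "simple_game N v" by (rule quota_game_simps)
  have vec: "coalition_vector N v S = restrict q P" if "S \<in> minimal_winning_coalitions N v" for S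
    using quota_game_minimal_winning_vector[OF that]
    by (auto simp: coalition_vector_def quota_game_player_classes)
  obtain M where M: "M \<in> minimal_winning_coalitions N v"
    using ex_minimal_winning_subset[OF sg grand_coalition_winning[OF sg]] by blast
  have "minimal_winning_vectors N v = {restrict q P}"
    unfolding minimal_winning_vectors_def using vec M by (auto simp: image_iff)
  then show ?thesis by simp
qed

lemma quota_game_no_veto: "\<not> veto_player N v a"
proof
  assume veto: "veto_player N v a"
  have "q C \<le> card ((N - {a}) \<inter> C)" if C: "C \<in> P" for C
  proof -
    have "(N - {a}) \<inter> C = C - {a}" using quota_game_simps(7)[OF C] by blast
    moreover have "card C - 1 \<le> card (C - {a})"
      using quota_game_simps(8)[OF C] by (simp add: card_Diff_singleton_if)
    ultimately show ?thesis using quota_game_simps(5)[OF C] by simp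
  qed
  then have "N - {a} \<in> winning_coalitions N v" by (auto simp: quota_game_simps(6))
  then show False using veto by (auto simp: veto_player_def)
qed

text \<open>A minimal winning coalition below a coalition whose members in \<open>C\<close> form a set \<open>A\<close> of exactly
\<open>q C\<close> players must contain all of \<open>A\<close>, and \<open>A\<close> can be chosen to contain the given player.\<close>

lemma quota_game_no_null: "\<not> null_player N v a"
proof
  assume null: "null_player N v a"
  then have "a \<in> N" by (simp add: null_player_def)
  then obtain C where C: "C \<in> P" "a \<in> C"
    using partition_onD1[OF quota_game_simps(2)] by auto
  obtain A where A: "A \<subseteq> C" "a \<in> A" "card A = q C"
    using quota_game_ex_quota_subset[OF C] by blast
  obtain T where T: "T \<in> minimal_winning_coalitions N v" "T \<subseteq> A \<union> (N - C - {})"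
    using ex_minimal_winning_subset[OF quota_game_simps(1)
        quota_game_tight_coalition(1)[OF C(1) A(1,3), of "{}"]]
    by auto
  have "T \<inter> C \<subseteq> A" using T(2) by blast
  moreover have "card (T \<inter> C) = card A"
    using quota_game_minimal_winning_vector[OF T(1) C(1)] A(3) by simp
  moreover have "finite A" using A(1) quota_game_simps(8)[OF C(1)] by (rule finite_subset)
  ultimately have "T \<inter> C = A" using card_subset_eq by blast
  then show False using null T(1) A(2) by (auto simp: null_player_def)
qed

end

lemma quota_game_in_SG:
  assumes "quota_game N v P q"
  shows "(N, v) \<in> SG_games (card N) (card P) 1"
  using quota_game_simps(1)[OF assms] quota_game_player_classes[OF assms]
    quota_game_one_minimal_winning_vector[OF assms] quota_game_no_veto[OF assms]
    quota_game_no_null[OF assms]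
  by (simp add: SG_games_def)

section \<open>The complete isomorphism invariant\<close>

text \<open>For a quota game this recovers the given quota (lemma \<open>quota_game_quota\<close>); defining it from the
winning coalitions alone makes the type of a game independent of any choice of quotas.\<close>

definition quota :: "'a set \<Rightarrow> ('a set \<Rightarrow> nat) \<Rightarrow> 'a set \<Rightarrow> nat" where
  "quota N v C = (LEAST k. \<exists>S\<in>winning_coalitions N v. card (S \<inter> C) = k)"

definition game_type :: "'a set \<times> ('a set \<Rightarrow> nat) \<Rightarrow> (nat \<times> nat) multiset" where
  "game_type G = (case G of (N, v) \<Rightarrow>
     image_mset (\<lambda>C. (quota N v C, card C - quota N v C)) (mset_set (player_classes N v)))"

lemma quota_game_quota:
  assumes "quota_game N v P q" "C \<in> P"
  shows "quota N v C = q C"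
  unfolding quota_def
proof (rule Least_equality)
  note simps = quota_game_simps[OF assms(1)]
  have "q C \<le> card C" using simps(5)[OF assms(2)] by simp
  then obtain A where A: "A \<subseteq> C" "card A = q C" by (rule obtain_subset_with_card_n)
  have "A \<union> (N - C - {}) \<in> winning_coalitions N v" "(A \<union> (N - C - {})) \<inter> C = A"
    by (rule quota_game_tight_coalition[OF assms A]; simp)+
  then show "\<exists>S\<in>winning_coalitions N v. card (S \<inter> C) = q C"
    using A(2) by metis
  show "q C \<le> k" if "\<exists>S\<in>winning_coalitions N v. card (S \<inter> C) = k" for k
    using that assms(2) by (auto simp: simps(6))
qed

lemma game_type_quota_game:
  assumes "quota_game N v P q"
  shows "game_type (N, v) = image_mset (\<lambda>C. (q C, card C - q C)) (mset_set P)"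
proof -
  have "finite P"
    using quota_game_simps[OF assms] finite_elements by blast
  then show ?thesis
    by (simp add: game_type_def quota_game_player_classes[OF assms])
      (intro image_mset_cong, simp add: quota_game_quota[OF assms])
qed

text \<open>The players on both sides may have different types, because games are first built on pairs of
numbers and then moved to natural numbers.\<close>

lemma quota_game_transport:
  assumes "quota_game N v P q" "simple_game N' v'" and f: "bij_betw f N N'"
    and win: "\<And>S. S \<subseteq> N \<Longrightarrow> S \<in> winning_coalitions N v \<longleftrightarrow> f ` S \<in> winning_coalitions N' v'"
  shows "quota_game N' v' ((`) f ` P) (\<lambda>D. q (inv_into N f ` D))"
proof -
  note simps = quota_game_simps[OF assms(1)]
  have inj: "inj_on f N" and img: "f ` N = N'" using f by (simp_all add: bij_betw_def)
  have restore: "inv_into N f ` f ` C = C" if "C \<subseteq> N" for C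
    using inj that by (rule inv_into_image_cancel)
  have cardf: "card (f ` C) = card C" if "C \<subseteq> N" for C
    using inj that by (intro card_image) (rule inj_on_subset)
  have W: "winning_coalitions N' v' =
    {S. S \<subseteq> N' \<and> (\<forall>C\<in>(`) f ` P. q (inv_into N f ` C) \<le> card (S \<inter> C))}"
  proof (rule set_eqI)
    fix T
    show "T \<in> winning_coalitions N' v' \<longleftrightarrow>
      T \<in> {S. S \<subseteq> N' \<and> (\<forall>C\<in>(`) f ` P. q (inv_into N f ` C) \<le> card (S \<inter> C))}"
    proof (cases "T \<subseteq> N'")
      case True
      then obtain S where S: "S \<subseteq> N" "T = f ` S" using img by (metis subset_imageE)
      have "card (f ` S \<inter> f ` C) = card (S \<inter> C)" if "C \<in> P" for C
        using inj_on_image_Int[OF inj S(1) simps(7)[OF that]] S(1) cardf[of "S \<inter> C"] by auto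
      then show ?thesis
        using S True win[OF S(1)] by (auto simp: simps(6) restore[OF simps(7)])
    qed (auto simp: winning_coalitions_def)
  qed
  have part: "partition_on N' ((`) f ` P)"
  proof (rule partition_onI)
    show "\<Union>((`) f ` P) = N'" using partition_onD1[OF simps(2)] img by auto
    show "disjnt C D" if "C \<in> (`) f ` P" "D \<in> (`) f ` P" "C \<noteq> D" for C D
    proof -
      from that obtain C' D' where CD: "C' \<in> P" "D' \<in> P" "C = f ` C'" "D = f ` D'" "C' \<noteq> D'"
        by blast
      then have "C' \<inter> D' = {}" using quota_game_disjoint[OF assms(1)] by blast
      then show ?thesis
        using inj_on_image_Int[OF inj simps(7)[OF CD(1)] simps(7)[OF CD(2)]] CD
        by (auto simp: disjnt_def)
    qed
    show "{} \<notin> (`) f ` P" using partition_onD3[OF simps(2)] by auto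
  qed
  then show ?thesis
    unfolding quota_game_def using assms(2) W
    by (auto simp: restore[OF simps(7)] cardf[OF simps(7)] simps(4,5))
qed

lemma game_type_isomorphic:
  assumes "quota_game N v P q" "simple_game N' v'" "isomorphic_games (N, v) (N', v')"
  shows "game_type (N', v') = game_type (N, v)"
    and "\<exists>P' q'. quota_game N' v' P' q' \<and> card P' = card P"
proof -
  note simps = quota_game_simps[OF assms(1)]
  obtain f where f: "bij_betw f N N'"
    and win: "\<And>S. S \<subseteq> N \<Longrightarrow> S \<in> winning_coalitions N v \<longleftrightarrow> f ` S \<in> winning_coalitions N' v'"
    using assms(3) by (auto simp: isomorphic_games_def)
  let ?q = "\<lambda>D. q (inv_into N f ` D)"
  have qg: "quota_game N' v' ((`) f ` P) ?q"
    by (rule quota_game_transport[OF assms(1,2) f win])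
  have injf: "inj_on f N" using f by (rule bij_betw_imp_inj_on)
  have inj: "inj_on ((`) f) P"
    using inj_on_image_eq_iff[OF injf] simps(7) by (intro inj_onI) blast
  have "game_type (N', v') = image_mset (\<lambda>D. (?q D, card D - ?q D)) (mset_set ((`) f ` P))"
    by (rule game_type_quota_game[OF qg])
  also have "\<dots> = image_mset (\<lambda>C. (?q (f ` C), card (f ` C) - ?q (f ` C))) (mset_set P)"
    by (simp add: image_mset_mset_set[OF inj, symmetric] multiset.map_comp comp_def)
  also have "\<dots> = image_mset (\<lambda>C. (q C, card C - q C)) (mset_set P)"
  proof (rule image_mset_cong)
    fix C assume "C \<in># mset_set P"
    then have "C \<subseteq> N" using simps(7) finite_elements[OF simps(3,2)] by simp
    then have "inv_into N f ` f ` C = C" "card (f ` C) = card C"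
      using injf by (auto simp: inv_into_image_cancel card_image inj_on_subset)
    then show "(?q (f ` C), card (f ` C) - ?q (f ` C)) = (q C, card C - q C)" by simp
  qed
  also have "\<dots> = game_type (N, v)" by (rule game_type_quota_game[OF assms(1), symmetric])
  finally show "game_type (N', v') = game_type (N, v)" .
  show "\<exists>P' q'. quota_game N' v' P' q' \<and> card P' = card P"
    using qg card_image[OF inj] by blast
qed

text \<open>Equal multisets of values match up the indices: remove an arbitrary index on the left together with
some index on the right that has the same value.\<close>

lemma image_mset_eq_imp_bij:
  assumes "finite P" "finite Q" "image_mset g (mset_set P) = image_mset h (mset_set Q)"
  shows "\<exists>\<sigma>. bij_betw \<sigma> P Q \<and> (\<forall>C\<in>P. h (\<sigma> C) = g C)"
  using assms
proof (induction P arbitrary: Q rule: finite_induct)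
  case empty
  then have "Q = {}" by (simp add: mset_set_empty_iff)
  then show ?case by (auto simp: bij_betw_def)
next
  case (insert x P)
  have "g x \<in># image_mset h (mset_set Q)"
    using insert.prems(2) insert.hyps by (metis image_mset_add_mset mset_set.insert union_single_eq_member)
  then obtain y where y: "y \<in> Q" "h y = g x" using insert.prems(1) by auto
  then have "mset_set Q = add_mset y (mset_set (Q - {y}))"
    using insert.prems(1) by (metis mset_set.remove)
  then have "image_mset g (mset_set P) = image_mset h (mset_set (Q - {y}))"
    using insert.prems(2) insert.hyps y(2) by simp
  then obtain \<sigma> where \<sigma>: "bij_betw \<sigma> P (Q - {y})" "\<forall>C\<in>P. h (\<sigma> C) = g C"
    using insert.IH[of "Q - {y}"] insert.prems(1) by auto
  let ?\<sigma> = "\<sigma>(x := y)"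
  have "bij_betw ?\<sigma> P (Q - {y})"
    using \<sigma>(1) insert.hyps(2) by (subst bij_betw_cong[of _ _ \<sigma>]) auto
  moreover have "bij_betw ?\<sigma> {x} {y}" by (simp add: bij_betw_def)
  ultimately have "bij_betw ?\<sigma> ({x} \<union> P) ({y} \<union> (Q - {y}))"
    by (intro bij_betw_combine) auto
  moreover have "{y} \<union> (Q - {y}) = Q" using y by blast
  moreover have "\<forall>C\<in>insert x P. h (?\<sigma> C) = g C" using \<sigma>(2) y(2) insert.hyps(2) by auto
  ultimately show ?case by (metis insert_is_Un)
qed

text \<open>Equal types give a bijection between the blocks that keeps sizes and quotas. Bijections between
corresponding blocks are then glued to one of the players, which keeps the number of members of a
coalition in each block.\<close>

lemma isomorphic_if_same_type:
  assumes G: "quota_game N v P q" and H: "quota_game N' v' P' q'"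
    and eq: "game_type (N, v) = game_type (N', v')"
  shows "isomorphic_games (N, v) (N', v')"
proof -
  note Gs = quota_game_simps[OF G] and Hs = quota_game_simps[OF H]
  have fin: "finite P" "finite P'"
    using finite_elements[OF Gs(3) Gs(2)] finite_elements[OF Hs(3) Hs(2)] by auto
  have eq': "image_mset (\<lambda>C. (q C, card C - q C)) (mset_set P) =
    image_mset (\<lambda>C. (q' C, card C - q' C)) (mset_set P')"
    using eq by (simp add: game_type_quota_game[OF G] game_type_quota_game[OF H])
  obtain \<sigma> where \<sigma>: "bij_betw \<sigma> P P'"
    "\<forall>C\<in>P. (q' (\<sigma> C), card (\<sigma> C) - q' (\<sigma> C)) = (q C, card C - q C)"
    using image_mset_eq_imp_bij[OF fin eq'] by blast
  have \<sigma>P: "\<sigma> C \<in> P'" if "C \<in> P" for C using \<sigma>(1) that by (rule bij_betwE[rule_format])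
  have \<sigma>q: "q' (\<sigma> C) = q C" "card (\<sigma> C) = card C" if "C \<in> P" for C
    using \<sigma>(2) that Gs(5)[OF that] Hs(5)[OF \<sigma>P[OF that]] by auto
  have "\<forall>C\<in>P. \<exists>g. bij_betw g C (\<sigma> C)"
    using \<sigma>q Gs(8) Hs(8) \<sigma>P by (metis finite_same_card_bij)
  then obtain g where g: "\<And>C. C \<in> P \<Longrightarrow> bij_betw (g C) C (\<sigma> C)" by metis
  define f where "f x = g (THE C. C \<in> P \<and> x \<in> C) x" for x
  have fg: "f x = g C x" if "C \<in> P" "x \<in> C" for C x
  proof -
    have "(THE C. C \<in> P \<and> x \<in> C) = C"
      using that quota_game_disjoint[OF G] by (intro the_equality) auto
    then show ?thesis by (simp add: f_def)
  qed
  have fC: "bij_betw f C (\<sigma> C)" if "C \<in> P" for C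
    using bij_betw_cong[of C f "g C" "\<sigma> C"] fg[OF that] g[OF that] by simp
  have "disjoint_family_on \<sigma> P"
  proof (unfold disjoint_family_on_def, intro ballI impI)
    fix C D assume CD: "C \<in> P" "D \<in> P" "C \<noteq> D"
    then have "\<sigma> C \<noteq> \<sigma> D" using \<sigma>(1) by (metis bij_betw_def inj_on_def)
    then show "\<sigma> C \<inter> \<sigma> D = {}" using quota_game_disjoint[OF H] \<sigma>P CD by blast
  qed
  then have "bij_betw f (\<Union>C\<in>P. C) (\<Union>C\<in>P. \<sigma> C)"
    using fC by (rule bij_betw_UNION_disjoint)
  moreover have "(\<Union>C\<in>P. C) = N" using partition_onD1[OF Gs(2)] by simp
  moreover have "(\<Union>C\<in>P. \<sigma> C) = N'"
    using partition_onD1[OF Hs(2)] \<sigma>(1) by (metis bij_betw_imp_surj_on)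
  ultimately have f: "bij_betw f N N'" by simp
  have "S \<in> winning_coalitions N v \<longleftrightarrow> f ` S \<in> winning_coalitions N' v'" if S: "S \<subseteq> N" for S
  proof -
    have card: "card (f ` S \<inter> \<sigma> C) = card (S \<inter> C)" if C: "C \<in> P" for C
    proof -
      have inj: "inj_on f N" using f by (rule bij_betw_imp_inj_on)
      have "f ` S \<inter> \<sigma> C = f ` (S \<inter> C)"
        using inj_on_image_Int[OF inj S Gs(7)[OF C]] fC[OF C] by (simp add: bij_betw_def)
      then show ?thesis using inj S by (metis card_image inj_on_subset le_infI1)
    qed
    have "f ` S \<subseteq> N'" using f S by (auto simp: bij_betw_def)
    moreover have "(\<forall>D\<in>P'. q' D \<le> card (f ` S \<inter> D)) \<longleftrightarrow> (\<forall>C\<in>P. q' (\<sigma> C) \<le> card (f ` S \<inter> \<sigma> C))"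
      using \<sigma>(1) by (metis (no_types, lifting) bij_betw_imp_surj_on image_iff)
    ultimately show ?thesis using S by (simp add: Gs(6) Hs(6) card \<sigma>q(1))
  qed
  then show ?thesis using f by (auto simp: isomorphic_games_def)
qed

section \<open>Games as weighted multisets\<close>

definition weighted_multisets :: "'a set \<Rightarrow> ('a \<Rightarrow> nat) \<Rightarrow> nat \<Rightarrow> nat \<Rightarrow> 'a multiset set" where
  "weighted_multisets X w t n = {M. set_mset M \<subseteq> X \<and> size M = t \<and> (\<Sum>x\<in>#M. w x) = n}"

definition pos_pairs :: "(nat \<times> nat) set" where
  "pos_pairs = {(a, b). 0 < a \<and> 0 < b}"

definition pair_sum :: "nat \<times> nat \<Rightarrow> nat" where
  "pair_sum x = fst x + snd x"

lemma game_type_in_weighted_multisets: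
  assumes "quota_game N v P q"
  shows "game_type (N, v) \<in> weighted_multisets pos_pairs pair_sum (card P) (card N)"
proof -
  note simps = quota_game_simps[OF assms]
  have fin: "finite P" by (rule finite_elements[OF simps(3,2)])
  have "(\<Sum>x\<in>#game_type (N, v). pair_sum x) = (\<Sum>C\<in>P. q C + (card C - q C))"
    by (simp add: game_type_quota_game[OF assms] pair_sum_def sum_unfold_sum_mset
        multiset.map_comp comp_def)
  also have "\<dots> = (\<Sum>C\<in>P. card C)"
    using simps(5) by (intro sum.cong) (auto simp: less_imp_le)
  also have "\<dots> = card (\<Union>P)"
    using partition_onD2[OF simps(2)] simps(8)
    by (intro card_Union_disjoint[symmetric]) (auto simp: disjoint_def pairwise_def disjnt_def)
  also have "\<Union>P = N" using partition_onD1[OF simps(2)] by simp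
  finally show ?thesis
    using fin simps(4,5)
    by (auto simp: weighted_multisets_def game_type_quota_game[OF assms] pos_pairs_def)
qed

text \<open>The block for the \<open>i\<close>-th pair \<open>(a, b)\<close> is \<open>{i} \<times> {..<a + b}\<close> with quota \<open>a\<close>. For \<open>t = 0\<close> there
would be no players, so the empty multiset is not the type of a game.\<close>

lemma ex_quota_game_of_type:
  assumes M: "M \<in> weighted_multisets pos_pairs pair_sum t n" and "t > 0"
  shows "\<exists>N v P q. quota_game (N :: (nat \<times> nat) set) v P q \<and> card N = n \<and> card P = t \<and>
    game_type (N, v) = M"
proof -
  obtain xs where xs: "mset xs = M" by (metis ex_mset)
  have len: "length xs = t" using M xs by (auto simp: weighted_multisets_def)
  have pos: "0 < fst (xs ! i)" "0 < snd (xs ! i)" if "i < t" for i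
  proof -
    have "xs ! i \<in> pos_pairs"
      using M xs len that by (auto simp: weighted_multisets_def dest!: subsetD)
    then show "0 < fst (xs ! i)" "0 < snd (xs ! i)" by (auto simp: pos_pairs_def)
  qed
  define B where "B i = {i} \<times> {..<pair_sum (xs ! i)}" for i
  define N where "N = (\<Union>i<t. B i)"
  define P where "P = B ` {..<t}"
  \<comment> \<open>Quotas are indexed by blocks; the first component of any player recovers the index.\<close>
  define q where "q C = fst (xs ! fst (SOME x. x \<in> C))" for C :: "(nat \<times> nat) set"
  define win where "win S \<longleftrightarrow> (\<forall>C\<in>P. q C \<le> card (S \<inter> C))" for S
  define v where "v = (\<lambda>S\<in>Pow N. of_bool (win S) :: nat)"
  have Bne: "B i \<noteq> {}" if "i < t" for i using pos[OF that] by (auto simp: B_def pair_sum_def)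
  have cardB: "card (B i) = pair_sum (xs ! i)" for i by (simp add: B_def card_cartesian_product_singleton)
  have qB: "q (B i) = fst (xs ! i)" if "i < t" for i
  proof -
    have "(SOME x. x \<in> B i) \<in> B i" using Bne[OF that] by (simp add: some_in_eq)
    then show ?thesis by (auto simp: q_def B_def)
  qed
  have injB: "inj_on B {..<t}"
    using Bne by (auto simp: inj_on_def B_def)
  have fin: "finite N" by (simp add: N_def B_def)
  have quota: "0 < q C \<and> q C < card C" if "C \<in> P" for C
    using that pos by (auto simp: P_def qB cardB pair_sum_def)
  have sub: "C \<subseteq> N" if "C \<in> P" for C using that by (auto simp: P_def N_def)
  have part: "partition_on N P"
    using Bne by (intro partition_onI) (auto simp: N_def P_def B_def disjnt_def)
  have v1: "v S = 1 \<longleftrightarrow> win S" "v S = of_bool (win S)" if "S \<subseteq> N" for S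
    using that by (auto simp: v_def)
  have "simple_game N v"
    unfolding simple_game_def
  proof (intro conjI allI impI)
    show "finite N" by (rule fin)
    show "N \<noteq> {}" using Bne[OF \<open>t > 0\<close>] \<open>t > 0\<close> by (auto simp: N_def)
    show "v \<in> Pow N \<rightarrow>\<^sub>E {0, 1}" by (auto simp: v_def)
    have "B 0 \<in> P" using \<open>t > 0\<close> by (auto simp: P_def)
    then have "\<not> win {}" using quota by (force simp: win_def)
    then show "v {} = 0" by (simp add: v_def)
    have "win N"
      using quota sub by (auto simp: win_def Int_absorb1 less_imp_le)
    then show "v N = 1" by (simp add: v_def)
    fix S T assume ST: "S \<subseteq> T \<and> T \<subseteq> N"
    have "card (S \<inter> C) \<le> card (T \<inter> C)" for C
      using ST fin by (intro card_mono) (auto intro: finite_subset)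
    then have "win S \<longrightarrow> win T" by (meson win_def le_trans)
    then show "v S \<le> v T" using ST by (auto simp: v1(2))
  qed
  then have qg: "quota_game N v P q"
    using part quota v1(1) by (auto simp: quota_game_def winning_coalitions_def win_def)
  have "game_type (N, v) = image_mset (\<lambda>i. xs ! i) (mset_set {..<t})"
    unfolding game_type_quota_game[OF qg] P_def image_mset_mset_set[OF injB, symmetric]
      multiset.map_comp comp_def
    by (intro image_mset_cong) (simp add: qB cardB pair_sum_def)
  also have "\<dots> = mset (map ((!) xs) [0..<t])"
    by (simp add: atLeast0LessThan[symmetric] flip: mset_upt)
  also have "\<dots> = M" using xs len by (metis map_nth)
  finally have type: "game_type (N, v) = M" .
  have "card P = t" using card_image[OF injB] by (simp add: P_def)
  moreover have "card N = n"
    using game_type_in_weighted_multisets[OF qg] M type by (simp add: weighted_multisets_def)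
  ultimately show ?thesis using qg type by blast
qed

lemma card_quotient_eq_card_image:
  assumes "\<And>x y. x \<in> A \<Longrightarrow> y \<in> A \<Longrightarrow> R x y \<longleftrightarrow> \<phi> x = \<phi> y"
  shows "card (A // {(x, y). x \<in> A \<and> y \<in> A \<and> R x y}) = card (\<phi> ` A)"
proof -
  let ?r = "{(x, y). x \<in> A \<and> y \<in> A \<and> R x y}"
  have "?r `` {x} = {y \<in> A. \<phi> y = \<phi> x}" if "x \<in> A" for x
    using assms that by auto
  then have "A // ?r = (\<lambda>z. {y \<in> A. \<phi> y = z}) ` \<phi> ` A"
    by (auto simp: quotient_def)
  moreover have "inj_on (\<lambda>z. {y \<in> A. \<phi> y = z}) (\<phi> ` A)"
    by (rule inj_onI) blast
  ultimately show ?thesis by (simp add: card_image)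
qed

lemma SG_eq_card_weighted_multisets:
  assumes "t > 0"
  shows "SG_no_veto_no_null n t 1 = card (weighted_multisets pos_pairs pair_sum t n)"
proof -
  have "isomorphic_games G H \<longleftrightarrow> game_type G = game_type H"
    if G: "G \<in> SG_games n t 1" and H: "H \<in> SG_games n t 1" for G H
  proof -
    obtain N v N' v' where GH: "G = (N, v)" "H = (N', v')" by fastforce
    obtain q where q: "quota_game N v (player_classes N v) q"
      using quota_game_of_SG G GH by blast
    obtain q' where q': "quota_game N' v' (player_classes N' v') q'"
      using quota_game_of_SG H GH by blast
    show ?thesis
      using game_type_isomorphic(1)[OF q quota_game_simps(1)[OF q']]
        isomorphic_if_same_type[OF q q'] GH by metis
  qed
  then have "SG_no_veto_no_null n t 1 = card (game_type ` SG_games n t 1)"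
    unfolding SG_no_veto_no_null_def isomorphism_classes_def
    by (rule card_quotient_eq_card_image)
  also have "game_type ` SG_games n t 1 = weighted_multisets pos_pairs pair_sum t n"
  proof (intro equalityI subsetI)
    fix M assume "M \<in> game_type ` SG_games n t 1"
    then obtain N v where G: "(N, v) \<in> SG_games n t 1" "M = game_type (N, v)" by force
    then obtain q where "quota_game N v (player_classes N v) q"
      using quota_game_of_SG by blast
    from game_type_in_weighted_multisets[OF this] show "M \<in> weighted_multisets pos_pairs pair_sum t n"
      using G by (simp add: SG_games_def)
  next
    fix M assume "M \<in> weighted_multisets pos_pairs pair_sum t n"
    then obtain N :: "(nat \<times> nat) set" and v P q where G: "quota_game N v P q" "card N = n"
      "card P = t" "game_type (N, v) = M"
      using ex_quota_game_of_type assms by metis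
    obtain v' where v': "simple_game {..<n} v'" "isomorphic_games (N, v) ({..<n}, v')"
      using simple_game_on_nat[OF quota_game_simps(1)[OF G(1)]] G(2) by auto
    have "({..<n}, v') \<in> SG_games n t 1"
      using game_type_isomorphic(2)[OF G(1) v'] quota_game_in_SG G(3) by fastforce
    moreover have "game_type ({..<n}, v') = M"
      using game_type_isomorphic(1)[OF G(1) v'] G(4) by simp
    ultimately show "M \<in> game_type ` SG_games n t 1" by blast
  qed
  finally show ?thesis .
qed

section \<open>Newton's identity for multisets\<close>

unbundle fps_syntax

lemma finite_weighted_multisets:
  assumes "\<And>n. finite {x \<in> X. w x = n}"
  shows "finite (weighted_multisets X w t n)"
proof (rule finite_subset)
  have "finite (\<Union>i\<le>n. {x \<in> X. w x = i})" using assms by blast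
  then have "finite {x \<in> X. w x \<le> n}" by (rule finite_subset[rotated]) auto
  then show "finite {M. set_mset M \<subseteq> {x \<in> X. w x \<le> n} \<and> size M = t}"
    using finite_multisets_of_size unfolding multisets_of_size_def by blast
  show "weighted_multisets X w t n \<subseteq> {M. set_mset M \<subseteq> {x \<in> X. w x \<le> n} \<and> size M = t}"
    unfolding weighted_multisets_def
    by (auto dest!: multi_member_split)
qed

text \<open>Both sides count the triples \<open>(M, x, k)\<close> with \<open>1 \<le> k \<le> count M x\<close>. For a fixed multiset \<open>M\<close> there
are \<open>size M = t\<close> of them. On the other hand, removing \<open>k\<close> copies of \<open>x\<close> from \<open>M\<close> turns such a triple
into a pair \<open>(k, x)\<close>, which takes \<open>k * w x\<close> of the weight, and an arbitrary multiset of size \<open>t - k\<close>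
that has the remaining weight.\<close>

lemma weighted_multisets_recurrence:
  assumes fib: "\<And>n. finite {x \<in> X. w x = n}"
  shows "t * card (weighted_multisets X w t n) =
    (\<Sum>k=1..t. \<Sum>i=0..n. card {x \<in> X. k * w x = i} * card (weighted_multisets X w (t - k) (n - i)))"
proof -
  let ?H = "weighted_multisets X w"
  have finH: "finite (?H s m)" for s m by (rule finite_weighted_multisets[OF fib])
  have finX: "finite {x \<in> X. k * w x = i}" if "k \<in> {1..t}" for k i
    by (rule finite_subset[OF _ fib[of "i div k"]]) (use that in auto)
  define A where "A = (SIGMA M:?H t n. SIGMA x:set_mset M. {1..count M x})"
  define B where "B = (SIGMA k:{1..t}. SIGMA i:{0..n}. {x \<in> X. k * w x = i} \<times> ?H (t - k) (n - i))"
  have "card A = (\<Sum>M\<in>?H t n. \<Sum>x\<in>set_mset M. count M x)"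
    by (simp add: A_def finH)
  also have "\<dots> = (\<Sum>M\<in>?H t n. t)"
    by (intro sum.cong refl) (auto simp: weighted_multisets_def size_multiset_overloaded_eq)
  finally have cardA: "card A = t * card (?H t n)" by simp
  have "card B = (\<Sum>k=1..t. card (SIGMA i:{0..n}. {x \<in> X. k * w x = i} \<times> ?H (t - k) (n - i)))"
    unfolding B_def by (rule card_SigmaI) (auto intro!: finite_SigmaI finX finH)
  also have "\<dots> = (\<Sum>k=1..t. \<Sum>i=0..n. card {x \<in> X. k * w x = i} * card (?H (t - k) (n - i)))"
    by (intro sum.cong refl) (simp add: finX finH card_cartesian_product)
  finally have cardB: "card B =
    (\<Sum>k=1..t. \<Sum>i=0..n. card {x \<in> X. k * w x = i} * card (?H (t - k) (n - i)))" .
  have "bij_betw (\<lambda>(M, x, k). (k, k * w x, x, M - replicate_mset k x)) A B"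
  proof (rule bij_betw_byWitness[where f' = "\<lambda>(k, i, x, M). (M + replicate_mset k x, x, k)"])
    have sub: "replicate_mset k x \<subseteq># M" if "k \<le> count M x" for k x and M :: "'a multiset"
      using that by (simp add: count_le_replicate_mset_subset_eq)
    show "\<forall>a\<in>A. (case case a of (M, x, k) \<Rightarrow> (k, k * w x, x, M - replicate_mset k x) of
        (k, i, x, M) \<Rightarrow> (M + replicate_mset k x, x, k)) = a"
      by (auto simp: A_def sub)
    show "\<forall>b\<in>B. (case case b of (k, i, x, M) \<Rightarrow> (M + replicate_mset k x, x, k) of
        (M, x, k) \<Rightarrow> (k, k * w x, x, M - replicate_mset k x)) = b"
      by (auto simp: B_def)
    show "(\<lambda>(M, x, k). (k, k * w x, x, M - replicate_mset k x)) ` A \<subseteq> B"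
    proof (rule image_subsetI)
      fix a assume "a \<in> A"
      then obtain M x k where a: "a = (M, x, k)" and M: "M \<in> ?H t n"
        and k: "1 \<le> k" "k \<le> count M x" by (auto simp: A_def)
      obtain M' where M': "M = M' + replicate_mset k x"
        using sub[OF k(2)] by (metis subset_mset.diff_add)
      show "(case a of (M, x, k) \<Rightarrow> (k, k * w x, x, M - replicate_mset k x)) \<in> B"
        using M k unfolding a M' by (auto simp: B_def weighted_multisets_def)
    qed
    show "(\<lambda>(k, i, x, M). (M + replicate_mset k x, x, k)) ` B \<subseteq> A"
      by (auto simp: A_def B_def weighted_multisets_def)
  qed
  then have "card A = card B" by (rule bij_betw_same_card)
  then show ?thesis using cardA cardB by simp
qed

definition multiset_gf :: "'a set \<Rightarrow> ('a \<Rightarrow> nat) \<Rightarrow> nat \<Rightarrow> real fps" where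
  "multiset_gf X w t = Abs_fps (\<lambda>n. real (card (weighted_multisets X w t n)))"

text \<open>The power sum symmetric function \<open>\<Sum>x\<in>X. y\<^sub>x ^ k\<close> at \<open>y\<^sub>x = X ^ w x\<close>, where the base is the
indeterminate of the power series.\<close>

definition power_sum_gf :: "'a set \<Rightarrow> ('a \<Rightarrow> nat) \<Rightarrow> nat \<Rightarrow> real fps" where
  "power_sum_gf X w k = Abs_fps (\<lambda>n. real (card {x \<in> X. k * w x = n}))"

lemma multiset_gf_recurrence:
  assumes "\<And>n. finite {x \<in> X. w x = n}"
  shows "of_nat t * multiset_gf X w t = (\<Sum>k=1..t. power_sum_gf X w k * multiset_gf X w (t - k))"
proof (rule fps_ext)
  fix n
  show "(of_nat t * multiset_gf X w t) $ n =
      (\<Sum>k=1..t. power_sum_gf X w k * multiset_gf X w (t - k)) $ n"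
    using arg_cong[OF weighted_multisets_recurrence[OF assms], of real t n]
    unfolding multiset_gf_def power_sum_gf_def fps_of_nat[symmetric] fps_mult_left_const_nth
      fps_sum_nth
    by (simp add: fps_mult_nth)
qed

lemma multiset_gf_0: "multiset_gf X w 0 = 1"
proof (rule fps_ext)
  fix n
  have "weighted_multisets X w 0 n = (if n = 0 then {{#}} else {})"
    by (auto simp: weighted_multisets_def)
  then show "multiset_gf X w 0 $ n = 1 $ n" by (simp add: multiset_gf_def)
qed

section \<open>The cycle index\<close>

text \<open>Cycle types of permutations of \<open>t\<close> points, padded to a fixed index set \<open>{1..T}\<close>: the recurrence
relates different \<open>t\<close>, and the functions in \<open>cycle_types t\<close> have a domain that depends on \<open>t\<close>.\<close>

definition bounded_cycle_types :: "nat \<Rightarrow> nat \<Rightarrow> (nat \<Rightarrow> nat) set" where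
  "bounded_cycle_types T t = {j \<in> {1..T} \<rightarrow>\<^sub>E UNIV. (\<Sum>k=1..T. k * j k) = t}"

definition cycle_term :: "(nat \<Rightarrow> real fps) \<Rightarrow> nat \<Rightarrow> (nat \<Rightarrow> nat) \<Rightarrow> real fps" where
  "cycle_term p T j = (\<Prod>k=1..T. fps_const (1 / (real k ^ j k * fact (j k))) * p k ^ j k)"

lemma bounded_cycle_types_le:
  assumes "j \<in> bounded_cycle_types T t" "k \<in> {1..T}"
  shows "k * j k \<le> t"
  using assms member_le_sum[of k "{1..T}" "\<lambda>k. k * j k"] by (auto simp: bounded_cycle_types_def)

lemma finite_bounded_cycle_types: "finite (bounded_cycle_types T t)"
proof (rule finite_subset)
  show "bounded_cycle_types T t \<subseteq> {1..T} \<rightarrow>\<^sub>E {..t}"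
  proof (rule subsetI, rule PiE_I)
    fix j k assume j: "j \<in> bounded_cycle_types T t"
    show "j k \<in> {..t}" if k: "k \<in> {1..T}"
    proof -
      have "j k \<le> k * j k" using k by simp
      also have "\<dots> \<le> t" by (rule bounded_cycle_types_le[OF j k])
      finally show ?thesis by simp
    qed
    show "j k = undefined" if "k \<notin> {1..T}"
      using j that by (auto simp: bounded_cycle_types_def PiE_iff extensional_def)
  qed
qed (auto intro: finite_PiE)

lemma bij_betw_add_cycle:
  assumes "k \<in> {1..T}" "k \<le> t"
  shows "bij_betw (\<lambda>j. j(k := Suc (j k))) (bounded_cycle_types T (t - k))
    {j \<in> bounded_cycle_types T t. 0 < j k}"
proof (rule bij_betw_byWitness[where f' = "\<lambda>j. j(k := j k - 1)"])
  have upd: "(\<Sum>i=1..T. i * (j(k := Suc (j k))) i) = k + (\<Sum>i=1..T. i * j i)" for j :: "nat \<Rightarrow> nat"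
    using assms(1) by (simp add: sum.remove[of _ k])
  show "(\<lambda>j. j(k := Suc (j k))) ` bounded_cycle_types T (t - k) \<subseteq> {j \<in> bounded_cycle_types T t. 0 < j k}"
  proof (intro image_subsetI CollectI conjI)
    fix j assume j: "j \<in> bounded_cycle_types T (t - k)"
    then have "(\<Sum>i=1..T. i * (j(k := Suc (j k))) i) = t"
      using assms(2) unfolding upd by (simp add: bounded_cycle_types_def)
    moreover have "j(k := Suc (j k)) \<in> {1..T} \<rightarrow>\<^sub>E UNIV"
      using j assms(1) by (auto simp: bounded_cycle_types_def PiE_iff extensional_def)
    ultimately show "j(k := Suc (j k)) \<in> bounded_cycle_types T t"
      unfolding bounded_cycle_types_def by blast
  qed simp
  show "(\<lambda>j. j(k := j k - 1)) ` {j \<in> bounded_cycle_types T t. 0 < j k} \<subseteq> bounded_cycle_types T (t - k)"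
  proof (rule image_subsetI)
    fix j assume "j \<in> {j \<in> bounded_cycle_types T t. 0 < j k}"
    then have j: "j \<in> bounded_cycle_types T t" "0 < j k" by auto
    let ?j = "j(k := j k - 1)"
    have "?j(k := Suc (?j k)) = j" using j(2) by (simp add: fun_eq_iff)
    then have "(\<Sum>i=1..T. i * j i) = k + (\<Sum>i=1..T. i * ?j i)" using upd[of ?j] by simp
    moreover have "(\<Sum>i=1..T. i * j i) = t" using j(1) by (simp add: bounded_cycle_types_def)
    ultimately have "(\<Sum>i=1..T. i * ?j i) = t - k" by linarith
    moreover have "?j \<in> {1..T} \<rightarrow>\<^sub>E UNIV"
      using j(1) assms(1) by (auto simp: bounded_cycle_types_def PiE_iff extensional_def)
    ultimately show "?j \<in> bounded_cycle_types T (t - k)"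
      unfolding bounded_cycle_types_def by blast
  qed
qed auto

text \<open>The factor \<open>k * Suc (j k)\<close> is the ratio of \<open>k ^ m * fact m\<close> at \<open>m = Suc (j k)\<close> and at \<open>m = j k\<close>.\<close>

lemma cycle_term_add_cycle:
  assumes "k \<in> {1..T}"
  shows "of_nat (k * Suc (j k)) * cycle_term p T (j(k := Suc (j k))) = p k * cycle_term p T j"
proof -
  let ?c = "\<lambda>i m. fps_const (1 / (real i ^ m * fact m)) * p i ^ m"
  let ?R = "\<Prod>i\<in>{1..T} - {k}. ?c i (j i)"
  have "cycle_term p T (j(k := Suc (j k))) = ?c k (Suc (j k)) * ?R"
    using assms by (simp add: cycle_term_def prod.remove[of _ k])
  moreover have "cycle_term p T j = ?c k (j k) * ?R"
    using assms by (simp add: cycle_term_def prod.remove[of _ k])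
  moreover have "of_nat (k * Suc (j k)) * ?c k (Suc (j k)) = p k * ?c k (j k)"
  proof -
    have "real (k * Suc (j k)) * (1 / (real k ^ Suc (j k) * fact (Suc (j k)))) =
        1 / (real k ^ j k * fact (j k))"
      using assms by (simp add: divide_simps) (simp add: algebra_simps)
    then have "fps_const (real (k * Suc (j k))) * fps_const (1 / (real k ^ Suc (j k) * fact (Suc (j k)))) =
        fps_const (1 / (real k ^ j k * fact (j k)))"
      by (simp only: fps_const_mult)
    moreover have "(of_nat (k * Suc (j k)) :: real fps) = fps_const (real (k * Suc (j k)))"
      by (rule fps_of_nat[symmetric])
    ultimately show ?thesis by (simp only: mult.assoc[symmetric] power_Suc) (simp only: mult_ac)
  qed
  ultimately show ?thesis by (simp only: mult.assoc[symmetric])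
qed

text \<open>On the left, replace \<open>t\<close> by \<open>\<Sum>k. k * j k\<close>; the part belonging to \<open>k\<close> vanishes unless \<open>j\<close> has a cycle
of length \<open>k\<close>, and removing one such cycle is a bijection onto the cycle types of \<open>t - k\<close> points.\<close>

lemma cycle_sum_recurrence:
  assumes "t \<le> T"
  shows "of_nat t * (\<Sum>j\<in>bounded_cycle_types T t. cycle_term p T j) =
    (\<Sum>k=1..t. p k * (\<Sum>j\<in>bounded_cycle_types T (t - k). cycle_term p T j))"
proof -
  let ?B = "bounded_cycle_types T" and ?c = "cycle_term p T"
  have "of_nat t * sum ?c (?B t) = (\<Sum>j\<in>?B t. \<Sum>k=1..T. of_nat (k * j k) * ?c j)"
    unfolding sum_distrib_left sum_distrib_right[symmetric] of_nat_sum[symmetric]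
    by (intro sum.cong refl) (simp add: bounded_cycle_types_def)
  also have "\<dots> = (\<Sum>k=1..T. \<Sum>j\<in>?B t. of_nat (k * j k) * ?c j)" by (rule sum.swap)
  also have "\<dots> = (\<Sum>k=1..T. if k \<le> t then p k * sum ?c (?B (t - k)) else 0)"
  proof (rule sum.cong[OF refl])
    fix k assume k: "k \<in> {1..T}"
    have "(\<Sum>j\<in>?B t. of_nat (k * j k) * ?c j) = (\<Sum>j | j \<in> ?B t \<and> 0 < j k. of_nat (k * j k) * ?c j)"
      by (intro sum.mono_neutral_right) (auto simp: finite_bounded_cycle_types)
    also have "\<dots> = (if k \<le> t then p k * sum ?c (?B (t - k)) else 0)"
    proof (cases "k \<le> t")
      case True
      have "(\<Sum>j | j \<in> ?B t \<and> 0 < j k. of_nat (k * j k) * ?c j) =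
          (\<Sum>j\<in>?B (t - k). of_nat (k * Suc (j k)) * ?c (j(k := Suc (j k))))"
        using sum.reindex_bij_betw[OF bij_betw_add_cycle[OF k True], of "\<lambda>j. of_nat (k * j k) * ?c j"]
        by (simp only: fun_upd_same)
      then show ?thesis using True k by (simp only: cycle_term_add_cycle sum_distrib_left if_True)
    next
      case False
      have zero: "j k = 0" if "j \<in> ?B t" for j
      proof -
        have "k * j k \<le> t" by (rule bounded_cycle_types_le[OF that k])
        then show ?thesis using False by (cases "j k") auto
      qed
      then have "{j. j \<in> ?B t \<and> 0 < j k} = {}" using zero by auto
      then show ?thesis using False by (simp only: sum.empty if_False)
    qed
    finally show "(\<Sum>j\<in>?B t. of_nat (k * j k) * ?c j) =
      (if k \<le> t then p k * sum ?c (?B (t - k)) else 0)" .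
  qed
  also have "\<dots> = (\<Sum>k=1..t. p k * sum ?c (?B (t - k)))"
    by (rule sum.mono_neutral_cong_right) (use assms in auto)
  finally show ?thesis .
qed

lemma bounded_cycle_types_0: "bounded_cycle_types T 0 = {\<lambda>k\<in>{1..T}. 0}"
proof (intro equalityI subsetI)
  fix j assume "j \<in> bounded_cycle_types T 0"
  then have "j \<in> extensional {1..T}" "\<And>k. k \<in> {1..T} \<Longrightarrow> j k = 0"
    by (auto simp: bounded_cycle_types_def PiE_iff)
  then show "j \<in> {\<lambda>k\<in>{1..T}. 0}" by (auto simp: fun_eq_iff extensional_def)
qed (auto simp: bounded_cycle_types_def)

text \<open>Both sides are \<open>1\<close> at \<open>t = 0\<close> and satisfy the same recurrence, in which \<open>of_nat t\<close> can be cancelled.\<close>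

lemma multiset_gf_eq_bounded_cycle_sum:
  assumes fib: "\<And>n. finite {x \<in> X. w x = n}" and "t \<le> T"
  shows "multiset_gf X w t = (\<Sum>j\<in>bounded_cycle_types T t. cycle_term (power_sum_gf X w) T j)"
  using assms(2)
proof (induction t rule: less_induct)
  case (less t)
  let ?p = "power_sum_gf X w"
  show ?case
  proof (cases "t = 0")
    case True
    then show ?thesis by (simp add: multiset_gf_0 bounded_cycle_types_0 cycle_term_def)
  next
    case False
    have "of_nat t * multiset_gf X w t = (\<Sum>k=1..t. ?p k * multiset_gf X w (t - k))"
      by (rule multiset_gf_recurrence[OF fib])
    also have "\<dots> = (\<Sum>k=1..t. ?p k * (\<Sum>j\<in>bounded_cycle_types T (t - k). cycle_term ?p T j))"
      using less by (intro sum.cong refl) simp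
    also have "\<dots> = of_nat t * (\<Sum>j\<in>bounded_cycle_types T t. cycle_term ?p T j)"
      by (rule cycle_sum_recurrence[OF less.prems, symmetric])
    finally show ?thesis using False by simp
  qed
qed

lemma multiset_gf_eq_cycle_sum:
  assumes "\<And>n. finite {x \<in> X. w x = n}"
  shows "multiset_gf X w t = (\<Sum>j\<in>cycle_types t. cycle_term (power_sum_gf X w) t j)"
  using multiset_gf_eq_bounded_cycle_sum[OF assms order_refl]
  by (simp add: bounded_cycle_types_def cycle_types_def)

section \<open>Power sums of pairs of positive integers\<close>

text \<open>The expansion of \<open>(X^k / (1 - X^k)) ^ (r + 1)\<close>. The condition \<open>0 < n\<close> matters: \<open>n div k - 1\<close>
truncates to \<open>0\<close> at \<open>n = 0\<close>, and \<open>0 choose 0 = 1\<close>.\<close>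

definition dilated_binomial_gf :: "nat \<Rightarrow> nat \<Rightarrow> real fps" where
  "dilated_binomial_gf k r =
     Abs_fps (\<lambda>n. if 0 < n \<and> k dvd n then real ((n div k - 1) choose r) else 0)"

text \<open>Multiplying by \<open>1 - X^k\<close> takes differences at distance \<open>k\<close>, so Pascal's rule lowers \<open>r\<close> by one.\<close>

lemma dilated_binomial_gf_closed_form:
  assumes "k > 0"
  shows "dilated_binomial_gf k r * (1 - fps_X ^ k) ^ Suc r = fps_X ^ (k * Suc r)"
proof (induction r)
  case 0
  have "dilated_binomial_gf k 0 * (1 - fps_X ^ k) = fps_X ^ k"
  proof (rule fps_ext)
    fix n
    show "(dilated_binomial_gf k 0 * (1 - fps_X ^ k)) $ n = (fps_X ^ k :: real fps) $ n"
      using assms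
      by (auto simp: right_diff_distrib fps_X_power_mult_right_nth fps_X_power_nth
          dilated_binomial_gf_def dvd_minus_self dest: dvd_imp_le)
  qed
  then show ?case by simp
next
  case (Suc r)
  have pascal: "dilated_binomial_gf k (Suc r) * (1 - fps_X ^ k) = dilated_binomial_gf k r * fps_X ^ k"
  proof (rule fps_ext)
    fix n
    show "(dilated_binomial_gf k (Suc r) * (1 - fps_X ^ k)) $ n = (dilated_binomial_gf k r * fps_X ^ k) $ n"
    proof (cases "k dvd n")
      case True
      then obtain m where m: "n = k * m" by blast
      consider "m = 0" | "m = 1" | m' where "m = Suc (Suc m')"
        by (metis One_nat_def not0_implies_Suc)
      then show ?thesis
        using assms m
        by cases (auto simp: right_diff_distrib fps_X_power_mult_right_nth dilated_binomial_gf_def)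
    next
      case False
      then have "\<not> k dvd n - k \<or> n < k" by (auto simp: dvd_minus_self)
      then show ?thesis
        using assms False
        by (auto simp: right_diff_distrib fps_X_power_mult_right_nth dilated_binomial_gf_def)
    qed
  qed
  have "dilated_binomial_gf k (Suc r) * (1 - fps_X ^ k) ^ Suc (Suc r) =
      (dilated_binomial_gf k (Suc r) * (1 - fps_X ^ k)) * (1 - fps_X ^ k) ^ Suc r"
    by (simp only: power_Suc mult_ac)
  also have "\<dots> = (dilated_binomial_gf k r * (1 - fps_X ^ k) ^ Suc r) * fps_X ^ k"
    unfolding pascal by (simp only: mult_ac)
  also have "\<dots> = fps_X ^ (k * Suc (Suc r))"
    unfolding Suc.IH by (simp add: power_add[symmetric])
  finally show ?case .
qed

text \<open>Both sides are powers of \<open>X^k / (1 - X^k)\<close> with exponent \<open>2 * j\<close>.\<close>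

lemma dilated_binomial_gf_power:
  assumes "k > 0" "j > 0"
  shows "dilated_binomial_gf k 1 ^ j = dilated_binomial_gf k (2 * j - 1)"
proof -
  let ?D = "(1 - fps_X ^ k) :: real fps"
  have "(dilated_binomial_gf k 1 * ?D ^ Suc 1) ^ j = fps_X ^ (k * (2 * j))"
    unfolding dilated_binomial_gf_closed_form[OF assms(1)] by (simp add: power_mult[symmetric] mult_ac)
  then have "dilated_binomial_gf k 1 ^ j * ?D ^ (2 * j) = fps_X ^ (k * (2 * j))"
    by (simp only: power_mult_distrib power_mult[symmetric]) (simp add: numeral_2_eq_2)
  moreover have "dilated_binomial_gf k (2 * j - 1) * ?D ^ (2 * j) = fps_X ^ (k * (2 * j))"
    using dilated_binomial_gf_closed_form[OF assms(1), of "2 * j - 1"] assms(2) by simp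
  moreover have "?D \<noteq> 0"
  proof
    assume "?D = 0"
    then have "?D $ 0 = 0" by simp
    then show False using assms(1) by simp
  qed
  ultimately show ?thesis by (metis mult_right_cancel power_not_zero)
qed

text \<open>Both sides are \<open>0\<close> when \<open>k\<close> does not divide \<open>n\<close>: there the indicator in \<open>F\<close> leaves \<open>0\<close> over
\<open>2 * j - 1\<close>, and \<open>2 * j - 1 > 0\<close>. At \<open>n = 0\<close> the upper argument in \<open>F\<close> is \<open>- 1\<close>.\<close>

lemma dilated_binomial_gf_nth:
  assumes "k > 0" "j > 0"
  shows "dilated_binomial_gf k (2 * j - 1) $ n = real (F k j n)"
proof (cases "k dvd n")
  case True
  then obtain m where m: "n = k * m" by blast
  show ?thesis
  proof (cases m)
    case 0
    have "- int k div int k = - 1"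
      using assms(1) nonzero_mult_div_cancel_right[of "int k" "- 1"] by simp
    then show ?thesis
      using 0 m by (simp add: dilated_binomial_gf_def F_def int_binomial_def)
  next
    case (Suc m')
    have "(int n - int k) div int k = int m'"
      using assms m Suc by (simp add: algebra_simps)
    then show ?thesis
      using assms m Suc by (simp add: dilated_binomial_gf_def F_def int_binomial_def)
  qed
next
  case False
  then have "n mod k \<noteq> 0" by (simp add: mod_eq_0_iff_dvd)
  then show ?thesis
    using assms(2) False by (simp add: dilated_binomial_gf_def F_def int_binomial_def binomial_eq_0)
qed

lemma pos_pairs_fibre: "{x \<in> pos_pairs. pair_sum x = m} = (\<lambda>a. (a, m - a)) ` {1..<m}"
  by (auto simp: pos_pairs_def pair_sum_def image_iff)

lemma finite_pos_pairs_fibre: "finite {x \<in> pos_pairs. pair_sum x = m}"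
  by (simp add: pos_pairs_fibre)

lemma power_sum_gf_pos_pairs:
  assumes "k > 0"
  shows "power_sum_gf pos_pairs pair_sum k = dilated_binomial_gf k 1"
proof (rule fps_ext)
  fix n
  have card: "card {x \<in> pos_pairs. pair_sum x = m} = m - 1" for m
    by (simp add: pos_pairs_fibre card_image inj_on_def)
  show "power_sum_gf pos_pairs pair_sum k $ n = dilated_binomial_gf k 1 $ n"
  proof (cases "k dvd n")
    case True
    then obtain m where m: "n = k * m" by blast
    then have "{x \<in> pos_pairs. k * pair_sum x = n} = {x \<in> pos_pairs. pair_sum x = m}"
      using assms by auto
    then show ?thesis
      using assms m card[of m] by (auto simp: power_sum_gf_def dilated_binomial_gf_def)
  next
    case False
    then have none: "{x \<in> pos_pairs. k * pair_sum x = n} = {}" by auto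
    have "card {x \<in> pos_pairs. k * pair_sum x = n} = 0" unfolding none by simp
    then show ?thesis using False by (simp add: power_sum_gf_def dilated_binomial_gf_def)
  qed
qed

section \<open>Convolutions and the enumeration formula\<close>

lemma dconv_list_gf:
  "Abs_fps (\<lambda>n. real (dconv_list fs n)) = prod_list (map (\<lambda>f. Abs_fps (\<lambda>n. real (f n))) fs)"
proof (induction fs rule: dconv_list.induct)
  case 1
  show ?case by (rule fps_ext) simp
next
  case (2 f)
  show ?case by simp
next
  case (3 f g fs)
  have "Abs_fps (\<lambda>n. real (dconv_list (f # g # fs) n)) =
      Abs_fps (\<lambda>n. real (f n)) * Abs_fps (\<lambda>n. real (dconv_list (g # fs) n))"
    by (rule fps_ext) (simp add: dconv_def fps_mult_nth)
  then show ?case using 3 by simp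
qed

text \<open>The indices with \<open>j k = 0\<close>, which the list omits, contribute the factor \<open>1\<close> to the product.\<close>

lemma dconv_list_F_gf:
  "Abs_fps (\<lambda>n. real (dconv_list (map (\<lambda>k. F k (j k)) (filter (\<lambda>k. j k \<noteq> 0) [1..<t + 1])) n)) =
    (\<Prod>k=1..t. power_sum_gf pos_pairs pair_sum k ^ j k)"
proof -
  let ?p = "power_sum_gf pos_pairs pair_sum" and ?ks = "filter (\<lambda>k. j k \<noteq> 0) [1..<t + 1]"
  have F_gf: "Abs_fps (\<lambda>n. real (F k (j k) n)) = ?p k ^ j k" if "k \<in> set ?ks" for k
    using that
    by (intro fps_ext)
      (simp add: power_sum_gf_pos_pairs dilated_binomial_gf_power dilated_binomial_gf_nth
        flip: One_nat_def)
  have "Abs_fps (\<lambda>n. real (dconv_list (map (\<lambda>k. F k (j k)) ?ks) n)) =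
      prod_list (map (\<lambda>k. Abs_fps (\<lambda>n. real (F k (j k) n))) ?ks)"
    by (simp only: dconv_list_gf map_map comp_def)
  also have "\<dots> = prod_list (map (\<lambda>k. ?p k ^ j k) ?ks)"
    using F_gf by (metis (no_types, lifting) map_cong)
  also have "\<dots> = (\<Prod>k\<in>set ?ks. ?p k ^ j k)"
    by (subst prod.distinct_set_conv_list) simp_all
  also have "\<dots> = (\<Prod>k=1..t. ?p k ^ j k)"
    by (rule prod.mono_neutral_left) (auto intro: gr0I)
  finally show ?thesis .
qed

lemma card_weighted_multisets_pos_pairs:
  "real (card (weighted_multisets pos_pairs pair_sum t n)) =
    (\<Sum>j\<in>cycle_types t.
       1 / (\<Prod>k=1..t. real k ^ j k * fact (j k)) *
       real (dconv_list (map (\<lambda>k. F k (j k)) (filter (\<lambda>k. j k \<noteq> 0) [1..<t + 1])) n))"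
proof -
  let ?p = "power_sum_gf pos_pairs pair_sum"
  have const: "(\<Prod>k=1..t. fps_const (1 / (real k ^ j k * fact (j k)))) =
      fps_const (1 / (\<Prod>k=1..t. real k ^ j k * fact (j k)))" for j
    by (induction t) (simp_all add: prod.nat_ivl_Suc')
  have "real (card (weighted_multisets pos_pairs pair_sum t n)) = multiset_gf pos_pairs pair_sum t $ n"
    by (simp add: multiset_gf_def)
  also have "\<dots> = (\<Sum>j\<in>cycle_types t. cycle_term ?p t j $ n)"
    by (simp only: multiset_gf_eq_cycle_sum[OF finite_pos_pairs_fibre] fps_sum_nth)
  also have "\<dots> = (\<Sum>j\<in>cycle_types t. 1 / (\<Prod>k=1..t. real k ^ j k * fact (j k)) *
       real (dconv_list (map (\<lambda>k. F k (j k)) (filter (\<lambda>k. j k \<noteq> 0) [1..<t + 1])) n))"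
  proof (rule sum.cong[OF refl])
    fix j
    have "cycle_term ?p t j = fps_const (1 / (\<Prod>k=1..t. real k ^ j k * fact (j k))) *
        Abs_fps (\<lambda>n. real (dconv_list (map (\<lambda>k. F k (j k)) (filter (\<lambda>k. j k \<noteq> 0) [1..<t + 1])) n))"
      by (simp only: cycle_term_def prod.distrib const dconv_list_F_gf)
    then show "cycle_term ?p t j $ n = 1 / (\<Prod>k=1..t. real k ^ j k * fact (j k)) *
       real (dconv_list (map (\<lambda>k. F k (j k)) (filter (\<lambda>k. j k \<noteq> 0) [1..<t + 1])) n)"
      by (simp only: fps_mult_left_const_nth fps_nth_Abs_fps)
  qed
  finally show ?thesis .
qed

theorem theorem3p11:
  fixes n t :: nat
  assumes "n > 0" and "t > 0"
  shows "real (SG_no_veto_no_null n t 1) =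
    (\<Sum>j\<in>cycle_types t.
       1 / (\<Prod>k=1..t. real k ^ j k * fact (j k)) *
       real (dconv_list (map (\<lambda>k. F k (j k)) (filter (\<lambda>k. j k \<noteq> 0) [1..<t + 1])) n))"
  using SG_eq_card_weighted_multisets[OF assms(2), of n] card_weighted_multisets_pos_pairs[of t n]
  by simp

end
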